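(* Let $d=1$, i.e. consider the energy $I_\lambda(\mu)$ over Borel probability measures $\mu$ on the circle $\mathbb S^1$. Then, with uniqueness understood up to identifying measures $\mu,\nu$ with $\mu(E\cup -E)=\nu(E\cup -E)$ for all Borel $E\subset\mathbb S^1$: (i) For $-1<\lambda\le 0$, the uniform measure $\sigma$ on $\mathbb S^1$ is the unique minimizer of $I_\lambda$. (ii) For $0<\lambda<1$, the measure $\sigma$ is the unique maximizer of $I_\lambda$. (iii) For $\lambda=1$, the maximizers of $I_\lambda$ are exactly the orthogonally symmetric measures, which include both $\sigma$ and $\mu_{ONB}$. (iv) For $\lambda>1$, the unique maximizers of $I_\lambda$ are the measures of the form $\mu_{ONB}$.
   Context: For $x,y\in\mathbb S^1\subset\mathbb R^2$ let $\theta(x,y)=\arccos|x\cdot y|$ be the non-obtuse angle between the lines generated by $x$ and $y$. For $\lambda\neq0$ and a Borel probability measure $\mu$ on $\mathbb S^1$, $I_\lambda(\mu)=\int_{\mathbb S^1}\int_{\mathbb S^1}\theta(x,y)^\lambda\,d\mu(x)\,d\mu(y)$; for $\lambda=0$ the kernel is replaced by $-\log\theta(x,y)$. For $\lambda\le 0$ the kernel equals $+\infty$ when $\theta(x,y)=0$. A measure of the form $\mu_{ONB}$ is $\frac12(\delta_{e_1}+\delta_{e_2})$ where $\{e_1,e_2\}$ is an orthonormal basis of $\mathbb R^2$. Orthogonal symmetry is a projective notion: a measure $\mu$ on $\mathbb S^1$ is regarded as a measure on $\mathbb{RP}^1=\mathbb S^1/\{\pm1\}$ (its image under the quotient map), and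 it is called orthogonally symmetric if $\mu(E)=\mu(E^\perp)$ for all Borel $E\subset\mathbb{RP}^1$, where $E^\perp$ is the set of lines orthogonal to some line in $E$. *)

theory Defs
  imports "HOL-Probability.Probability"
begin

section \<open>Probability measures on the circle\<close>

abbreviation circle :: "(real^2) set" where
  "circle \<equiv> sphere 0 1"

definition circle_borel :: "(real^2) measure" where
  "circle_borel = restrict_space borel circle"

definition circle_probs :: "(real^2) measure set" where
  "circle_probs = {\<mu>. prob_space \<mu> \<and> sets \<mu> = sets circle_borel}"

text \<open>Normalized arc length: the image of the uniform distribution on the angles
  \<open>[0, 2\<pi>)\<close> under the standard parametrization.\<close>

definition uniform_circle :: "(real^2) measure" where
  "uniform_circle =
     distr (uniform_measure lborel {0..<2*pi}) circle_borel (\<lambda>t. vector [cos t, sin t])"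

definition orthonormal_basis :: "real^2 \<Rightarrow> real^2 \<Rightarrow> bool" where
  "orthonormal_basis e1 e2 \<longleftrightarrow> norm e1 = 1 \<and> norm e2 = 1 \<and> e1 \<bullet> e2 = 0"

text \<open>\<open>return circle_borel e\<close> is the Dirac measure at \<open>e\<close>.\<close>

definition mu_onb :: "real^2 \<Rightarrow> real^2 \<Rightarrow> (real^2) measure" where
  "mu_onb e1 e2 = measure_of circle (sets circle_borel)
     (\<lambda>E. (emeasure (return circle_borel e1) E + emeasure (return circle_borel e2) E) / 2)"

section \<open>The energy\<close>

definition theta :: "real^2 \<Rightarrow> real^2 \<Rightarrow> real" where
  "theta x y = arccos \<bar>x \<bullet> y\<bar>"

definition angle_kernel :: "real \<Rightarrow> real^2 \<Rightarrow> real^2 \<Rightarrow> ereal" where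
  "angle_kernel s x y =
     (if s \<le> 0 \<and> theta x y = 0 then \<infinity>
      else if s = 0 then ereal (- ln (theta x y))
      else ereal (theta x y powr s))"

text \<open>Integral of an extended-real function as the integral of its positive part minus the
  integral of its negative part (\<open>e2ennreal\<close> sends negative values to \<open>0\<close>). All kernels are
  bounded below, so for probability measures \<open>\<infinity> - \<infinity>\<close> does not occur. Integration has to be
  extended-real-valued since the energy may be \<open>\<infinity>\<close>, and signed since
  \<open>- ln (theta x y)\<close> is negative for \<open>theta x y > 1\<close>.\<close>

definition ereal_integral :: "'a measure \<Rightarrow> ('a \<Rightarrow> ereal) \<Rightarrow> ereal" where
  "ereal_integral M f =
     enn2ereal (\<integral>\<^sup>+x. e2ennreal (f x) \<partial>M) - enn2ereal (\<integral>\<^sup>+x. e2ennreal (- f x) \<partial>M)"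

definition energy :: "real \<Rightarrow> (real^2) measure \<Rightarrow> ereal" where
  "energy s \<mu> = ereal_integral \<mu> (\<lambda>y. ereal_integral \<mu> (\<lambda>x. angle_kernel s x y))"

definition minimizers :: "real \<Rightarrow> (real^2) measure set" where
  "minimizers s = {\<mu> \<in> circle_probs. \<forall>\<nu>\<in>circle_probs. energy s \<mu> \<le> energy s \<nu>}"

definition maximizers :: "real \<Rightarrow> (real^2) measure set" where
  "maximizers s = {\<mu> \<in> circle_probs. \<forall>\<nu>\<in>circle_probs. energy s \<nu> \<le> energy s \<mu>}"

section \<open>Projective notions\<close>

definition proj_equal :: "(real^2) measure \<Rightarrow> (real^2) measure \<Rightarrow> bool" where
  "proj_equal \<mu> \<nu> \<longleftrightarrow>
     (\<forall>E\<in>sets circle_borel. emeasure \<mu> (E \<union> uminus ` E) = emeasure \<nu> (E \<union> uminus ` E))"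

text \<open>A point of \<open>RP1\<close> is an antipodal pair \<open>{x, -x}\<close>; \<open>RP1_borel\<close> is generated by the open
  sets of the quotient topology.\<close>

definition proj :: "real^2 \<Rightarrow> (real^2) set" where
  "proj x = {x, - x}"

definition RP1 :: "(real^2) set set" where
  "RP1 = proj ` circle"

definition RP1_borel :: "(real^2) set measure" where
  "RP1_borel =
     sigma RP1 {U. U \<subseteq> RP1 \<and> openin (top_of_set circle) {x \<in> circle. proj x \<in> U}}"

definition perp :: "(real^2) set set \<Rightarrow> (real^2) set set" where
  "perp E = {l \<in> RP1. \<exists>m\<in>E. \<forall>x\<in>l. \<forall>y\<in>m. x \<bullet> y = 0}"

definition orthogonally_symmetric :: "(real^2) measure \<Rightarrow> bool" where
  "orthogonally_symmetric \<mu> \<longleftrightarrow>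
     (\<forall>E\<in>sets RP1_borel.
        emeasure (distr \<mu> RP1_borel proj) E = emeasure (distr \<mu> RP1_borel proj) (perp E))"

end

theory Submission
  imports Defs "HOL-Real_Asymp.Real_Asymp"
begin

text \<open>A line through the origin is recorded by its angle in \<open>(0, pi]\<close>. In these terms \<open>theta\<close>
is the arc distance \<open>d(u, v) = min \<bar>u - v\<bar> (pi - \<bar>u - v\<bar>)\<close>, so the energy of a measure depends only
on the law \<open>m\<close> of its angle, and projective equality is equality of these laws
(\<open>proj_equal_iff_angle_law\<close>). Up to the value of the kernel at distance \<open>pi/2\<close>, every kernel is
plus (\<open>s \<le> 0\<close>) or minus (\<open>s > 0\<close>) a nonnegative function \<open>gap s\<close> of \<open>d\<close> that vanishes at \<open>pi/2\<close>.
Both the minimization and the maximization problem therefore ask for the least double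
integral of \<open>gap s\<close>.

The main tool is the tent \<open>max 0 (a - d(u, v))\<close> with \<open>a \<le> pi/2\<close>: it is the length of the set of
\<open>z\<close> for which the arc from \<open>z\<close> to \<open>z + a\<close>, read modulo \<open>pi\<close>, contains both \<open>u\<close> and \<open>v\<close>
(\<open>arc_overlap\<close>). By Fubini the tent energy of \<open>m\<close> is the integral over \<open>z\<close> of the squared mass of
this arc. The mass has mean \<open>a/pi\<close> for every \<open>m\<close>, so the tent energy equals \<open>a\<^sup>2/pi\<close> plus the
integral of \<open>(m(arc) - a/pi)\<^sup>2\<close> (\<open>tent_energy\<close>), and it is least exactly if almost every arc of
length \<open>a\<close> carries its fair share \<open>a/pi\<close> of the mass.

For \<open>-1 < s < 1\<close> the function \<open>gap s\<close> is decreasing and strictly convex on \<open>(0, pi/2]\<close>, and Taylor's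
formula at \<open>pi/2\<close> with integral remainder writes it as a mixture of tents, with a positive density
\<open>w a\<close> over all lengths \<open>a < pi/2\<close> and a multiple of the tent of length \<open>pi/2\<close>
(\<open>gap_tent_mixture\<close>). A minimizer gives the fair share to almost
all arcs of almost all lengths, which forces the uniform law. The condition \<open>-1 < s\<close> makes the
uniform energy finite, so that equality of energies can be split into equality for each tent.

For \<open>s = 1\<close> the only tent is the one with \<open>a = pi/2\<close>. The minimizers are the laws for which almost
every arc of length \<open>pi/2\<close> has mass one half, which are the laws invariant under the rotation that
exchanges perpendicular lines (\<open>rot_invariant_iff_half_arcs\<close>).

For \<open>s > 1\<close> one has \<open>t powr s \<le> (pi/2) powr (s - 1) * t\<close> on \<open>[0, pi/2]\<close>, with equality only at the two
ends. The energy is thus at most a fixed multiple of the energy for \<open>s = 1\<close>. The measures \<open>mu_onb\<close>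
attain equality and also maximize the energy for \<open>s = 1\<close>, so every maximizer must do both: it is
invariant under the rotation and charges only two perpendicular lines.\<close>

section \<open>Tents are mean squares of arc masses\<close>

definition arc_dist :: "real \<Rightarrow> real \<Rightarrow> real" where
  "arc_dist u v = min \<bar>u - v\<bar> (pi - \<bar>u - v\<bar>)"

text \<open>The lines met on turning from angle \<open>z \<in> [0, pi)\<close> by \<open>a\<close>. The second alternative is the part
beyond \<open>pi\<close>, which starts again at angle \<open>0\<close>. The set is unbounded below because only angles in
\<open>(0, pi]\<close> ever matter, and this form expresses its mass by three values of the distribution
function.\<close>

definition line_arc :: "real \<Rightarrow> real \<Rightarrow> real set" where
  "line_arc a z = {u. z < u \<and> u \<le> z + a \<or> u \<le> z + a - pi}"

lemma emeasure_lborel_atLeastLessThan: "emeasure lborel {l..<u} = ennreal (u - l)" for l u :: real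
  by (cases "l \<le> u") (auto simp: ennreal_neg)

text \<open>For \<open>u \<le> v\<close> the admissible starting points form three intervals: both points before the
turn-over, \<open>v\<close> before and \<open>u\<close> after it, or both after it. For \<open>v - u \<le> pi/2\<close> the middle one is empty,
otherwise the other two are; this is where \<open>a \<le> pi/2\<close> enters. The truncation in \<open>ennreal\<close> turns
\<open>a - arc_dist u v\<close> into the tent.\<close>

lemma arc_overlap:
  assumes u: "0 < u" "u \<le> pi" and v: "0 < v" "v \<le> pi" and a: "0 \<le> a" "a \<le> pi/2"
  shows "(\<integral>\<^sup>+z. indicator {0..<pi} z * (indicator (line_arc a z) u * indicator (line_arc a z) v) \<partial>lborel)
    = ennreal (a - arc_dist u v)"
  using u v
proof (induction u v rule: linorder_wlog)
  case (sym u v)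
  then show ?case by (simp add: arc_dist_def abs_minus_commute mult.commute)
next
  case (le u v)
  have "(\<integral>\<^sup>+z. indicator {0..<pi} z * (indicator (line_arc a z) u * indicator (line_arc a z) v) \<partial>lborel)
     = (\<integral>\<^sup>+z. indicator {max 0 (v-a)..<u} z + indicator {u+pi-a..<v} z
          + indicator {v+pi-a..<pi} z \<partial>lborel)"
  proof (rule nn_integral_cong)
    fix z :: real
    consider "z < 0" | "pi \<le> z" | "0 \<le> z" "z < pi" "z \<in> {max 0 (v-a)..<u}"
      | "0 \<le> z" "z < pi" "z \<in> {u+pi-a..<v}" | "0 \<le> z" "z < pi" "z \<in> {v+pi-a..<pi}"
      | "0 \<le> z" "z < pi" "z \<notin> {max 0 (v-a)..<u}" "z \<notin> {u+pi-a..<v}" "z \<notin> {v+pi-a..<pi}"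
      by linarith
    then show "indicator {0..<pi} z * (indicator (line_arc a z) u * indicator (line_arc a z) v)
      = (indicator {max 0 (v-a)..<u} z + indicator {u+pi-a..<v} z + indicator {v+pi-a..<pi} z :: ennreal)"
      using le a by cases (auto simp: indicator_def line_arc_def)
  qed
  also have "\<dots> = ennreal (u - max 0 (v-a)) + ennreal (v - (u+pi-a)) + ennreal (pi - (v+pi-a))"
    by (simp add: nn_integral_add emeasure_lborel_atLeastLessThan)
  also have "\<dots> = ennreal (a - arc_dist u v)"
  proof (cases "v - u \<le> pi/2")
    case True
    then show ?thesis using le a
      by (cases "v \<le> a")
        (auto simp: arc_dist_def ennreal_neg algebra_simps simp flip: ennreal_plus)
  next
    case False
    then show ?thesis using le a
      by (auto simp: arc_dist_def ennreal_neg algebra_simps)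
  qed
  finally show ?case .
qed

text \<open>The two integrals are nested in the same order as in \<open>energy\<close>.\<close>

definition pair_energy :: "(real \<Rightarrow> ennreal) \<Rightarrow> real measure \<Rightarrow> ennreal" where
  "pair_energy K M = (\<integral>\<^sup>+v. \<integral>\<^sup>+u. K (arc_dist u v) \<partial>M \<partial>M)"

locale line_law = real_distribution +
  assumes support: "AE u in M. 0 < u \<and> u \<le> pi"
begin

lemma arc_pair_measurable [measurable]:
  "(\<lambda>(z, u). indicator (line_arc a z) u :: ennreal) \<in> borel_measurable (lborel \<Otimes>\<^sub>M M)"
proof -
  have eq: "(\<lambda>(z, u). indicator (line_arc a z) u :: ennreal) =
     indicator {p :: real \<times> real. fst p < snd p \<and> snd p \<le> fst p + a \<or> snd p \<le> fst p + a - pi}"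
    by (auto simp: fun_eq_iff line_arc_def indicator_def)
  show ?thesis unfolding eq by measurable
qed

lemma arc_sets [measurable]: "line_arc a z \<in> sets borel"
  unfolding line_arc_def by measurable

lemma measurable_emeasure_arc [measurable]: "(\<lambda>z. emeasure M (line_arc a z)) \<in> borel_measurable borel"
proof -
  have "(\<lambda>z. \<integral>\<^sup>+u. indicator (line_arc a z) u \<partial>M) \<in> borel_measurable lborel"
    by (rule borel_measurable_nn_integral[OF arc_pair_measurable])
  then show ?thesis by simp
qed

lemma measurable_measure_arc [measurable]: "(\<lambda>z. measure M (line_arc a z)) \<in> borel_measurable borel"
  unfolding measure_def by measurable

lemma measurable_arc_dist [measurable]:
  assumes [measurable]: "f \<in> borel_measurable N" "g \<in> borel_measurable N"
  shows "(\<lambda>x. arc_dist (f x) (g x)) \<in> borel_measurable N"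
  unfolding arc_dist_def by measurable

lemma tent_energy_eq_arcs:
  assumes a: "0 \<le> a" "a \<le> pi/2"
  shows "pair_energy (\<lambda>t. ennreal (a - t)) M
     = (\<integral>\<^sup>+z. indicator {0..<pi} z * (emeasure M (line_arc a z))\<^sup>2 \<partial>lborel)"
proof -
  interpret pair_sigma_finite lborel M ..
  let ?I = "\<lambda>z u. indicator (line_arc a z) u :: ennreal"
  have "pair_energy (\<lambda>t. ennreal (a - t)) M
     = (\<integral>\<^sup>+v. \<integral>\<^sup>+u. \<integral>\<^sup>+z. indicator {0..<pi} z * (?I z u * ?I z v) \<partial>lborel \<partial>M \<partial>M)"
    unfolding pair_energy_def
  proof (rule nn_integral_cong_AE, use support in eventually_elim)
    case (elim v)
    show ?case
      by (rule nn_integral_cong_AE, use support in eventually_elim)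
         (use elim a in \<open>simp add: arc_overlap\<close>)
  qed
  also have "\<dots> = (\<integral>\<^sup>+v. \<integral>\<^sup>+z. \<integral>\<^sup>+u. indicator {0..<pi} z * (?I z u * ?I z v) \<partial>M \<partial>lborel \<partial>M)"
    by (intro nn_integral_cong Fubini') (auto simp: line_arc_def)
  also have "\<dots> = (\<integral>\<^sup>+v. \<integral>\<^sup>+z. indicator {0..<pi} z * (emeasure M (line_arc a z) * ?I z v) \<partial>lborel \<partial>M)"
    by (simp add: nn_integral_cmult nn_integral_multc)
  also have "\<dots> = (\<integral>\<^sup>+z. \<integral>\<^sup>+v. indicator {0..<pi} z * (emeasure M (line_arc a z) * ?I z v) \<partial>M \<partial>lborel)"
    by (intro Fubini') measurable
  also have "\<dots> = (\<integral>\<^sup>+z. indicator {0..<pi} z * (emeasure M (line_arc a z))\<^sup>2 \<partial>lborel)"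
    by (simp add: nn_integral_cmult power2_eq_square)
  finally show ?thesis .
qed

text \<open>Each point lies in arcs whose starting points have total length \<open>a\<close>, which is the case \<open>u = v\<close>
of \<open>arc_overlap\<close>.\<close>

lemma integral_arcs:
  assumes a: "0 \<le> a" "a \<le> pi/2"
  shows "(\<integral>\<^sup>+z. indicator {0..<pi} z * emeasure M (line_arc a z) \<partial>lborel) = ennreal a"
proof -
  interpret pair_sigma_finite lborel M ..
  let ?I = "\<lambda>z u. indicator (line_arc a z) u :: ennreal"
  have "(\<integral>\<^sup>+z. indicator {0..<pi} z * emeasure M (line_arc a z) \<partial>lborel)
    = (\<integral>\<^sup>+z. \<integral>\<^sup>+u. indicator {0..<pi} z * (?I z u * ?I z u) \<partial>M \<partial>lborel)"
    by (simp add: nn_integral_cmult flip: indicator_inter_arith)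
  also have "\<dots> = (\<integral>\<^sup>+u. \<integral>\<^sup>+z. indicator {0..<pi} z * (?I z u * ?I z u) \<partial>lborel \<partial>M)"
    by (intro Fubini'[symmetric]) measurable
  also have "\<dots> = (\<integral>\<^sup>+u. ennreal a \<partial>M)"
    by (rule nn_integral_cong_AE, use support in eventually_elim)
       (use a in \<open>simp add: arc_overlap arc_dist_def\<close>)
  finally show ?thesis using emeasure_space_1 by simp
qed

text \<open>The failure of \<open>M\<close> to give arcs of length \<open>a\<close> their fair share of the mass.\<close>

definition arc_discrepancy :: "real \<Rightarrow> ennreal" where
  "arc_discrepancy a =
     (\<integral>\<^sup>+z. indicator {0..<pi} z * ennreal ((measure M (line_arc a z) - a / pi)\<^sup>2) \<partial>lborel)"

text \<open>Expand the square of the deviation of the arc mass from its mean \<open>a / pi\<close>. The cross term is known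
from \<open>integral_arcs\<close>. Since subtraction in \<open>ennreal\<close> is truncated, the constant \<open>a\<^sup>2 / pi\<close> is added
to both sides and cancelled at the end.\<close>

lemma tent_energy:
  assumes a: "0 \<le> a" "a \<le> pi/2"
  shows "pair_energy (\<lambda>t. ennreal (a - t)) M = ennreal (a\<^sup>2 / pi) + arc_discrepancy a"
    (is "?T = _ + ?V")
proof -
  let ?I = "indicator {0..<pi} :: real \<Rightarrow> ennreal"
  have "?T + ennreal (a\<^sup>2 / pi) = (\<integral>\<^sup>+z. ?I z * (emeasure M (line_arc a z))\<^sup>2 + ?I z * ennreal ((a/pi)\<^sup>2) \<partial>lborel)"
  proof (subst nn_integral_add)
    have "(\<integral>\<^sup>+z. ?I z * ennreal ((a/pi)\<^sup>2) \<partial>lborel) = ennreal (a\<^sup>2 / pi)"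
      by (simp add: nn_integral_multc flip: ennreal_mult) (simp add: power2_eq_square)
    then show "?T + ennreal (a\<^sup>2 / pi) = (\<integral>\<^sup>+z. ?I z * (emeasure M (line_arc a z))\<^sup>2 \<partial>lborel) +
       (\<integral>\<^sup>+z. ?I z * ennreal ((a/pi)\<^sup>2) \<partial>lborel)"
      by (simp add: tent_energy_eq_arcs[OF a])
  qed auto
  also have "\<dots> = (\<integral>\<^sup>+z. ennreal (2 * a / pi) * (?I z * emeasure M (line_arc a z))
      + ?I z * ennreal ((measure M (line_arc a z) - a / pi)\<^sup>2) \<partial>lborel)"
  proof (rule nn_integral_cong)
    fix z
    have "(measure M (line_arc a z))\<^sup>2 + (a/pi)\<^sup>2 = 2*a/pi * measure M (line_arc a z) + (measure M (line_arc a z) - a/pi)\<^sup>2"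
      by (simp add: power2_eq_square algebra_simps)
    then show "?I z * (emeasure M (line_arc a z))\<^sup>2 + ?I z * ennreal ((a/pi)\<^sup>2)
      = ennreal (2 * a / pi) * (?I z * emeasure M (line_arc a z)) + ?I z * ennreal ((measure M (line_arc a z) - a / pi)\<^sup>2)"
      using a by (simp add: emeasure_eq_measure indicator_def ennreal_power
          flip: ennreal_mult ennreal_plus)
  qed
  also have "\<dots> = ennreal (2 * a / pi) * ennreal a + ?V"
    by (simp add: nn_integral_add nn_integral_cmult integral_arcs[OF a] arc_discrepancy_def)
  also have "ennreal (2 * a / pi) * ennreal a = ennreal (a\<^sup>2/pi) + ennreal (a\<^sup>2/pi)"
    using a by (simp add: power2_eq_square flip: ennreal_mult ennreal_plus)
  finally have "ennreal (a\<^sup>2/pi) + ?T = ennreal (a\<^sup>2/pi) + (ennreal (a\<^sup>2/pi) + ?V)"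
    by (simp add: ac_simps)
  then show ?thesis
    by (simp only: ennreal_add_left_cancel) simp
qed

end

section \<open>Angle laws are determined by their arcs\<close>

text \<open>Upgrades the almost-everywhere statements about arcs to statements about all arcs: a point
where the value differs would have a whole interval of such points on its right.\<close>

lemma right_continuous_AE_const:
  fixes g :: "real \<Rightarrow> real"
  assumes cont: "\<And>z. l \<le> z \<Longrightarrow> z < r \<Longrightarrow> continuous (at_right z) g"
    and AE: "AE z in lborel. l < z \<longrightarrow> z < r \<longrightarrow> g z = c"
    and z: "l \<le> z" "z < r"
  shows "g z = c"
proof (rule ccontr)
  assume ne: "g z \<noteq> c"
  have "(g \<longlongrightarrow> g z) (at_right z)"
    using cont[OF z] by (simp add: continuous_within)
  then have "\<forall>\<^sub>F x in at_right z. g x \<noteq> c"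
    using ne by (rule tendsto_imp_eventually_ne)
  then obtain b where b: "z < b" "\<And>x. z < x \<Longrightarrow> x < b \<Longrightarrow> g x \<noteq> c"
    unfolding eventually_at_right_field by blast
  have "AE x in lborel. x \<notin> {z<..<min b r}"
    using AE by eventually_elim (use b z in force)
  then have "{z<..<min b r} \<in> null_sets lborel"
    by (subst AE_iff_null_sets) auto
  then have "emeasure lborel {z<..<min b r} = 0"
    by auto
  then show False
    using b z by (auto split: if_splits)
qed

text \<open>Rotation of a line by a quarter turn, in terms of its angle in \<open>(0, pi]\<close>.\<close>

definition rot :: "real \<Rightarrow> real" where
  "rot u = (if u \<le> pi/2 then u + pi/2 else u - pi/2)"

lemma rot_measurable [measurable]: "rot \<in> borel_measurable borel"
  unfolding rot_def by measurable

context line_law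
begin

lemma cdf_nonpos: "x \<le> 0 \<Longrightarrow> cdf M x = 0"
  unfolding cdf_def2 by (rule prob_eq_0[THEN iffD2]) (use support in \<open>auto elim: AE_mp\<close>)

lemma cdf_ge_pi: "pi \<le> x \<Longrightarrow> cdf M x = 1"
  unfolding cdf_def2 by (rule prob_eq_1[THEN iffD2]) (use support in \<open>auto elim: AE_mp\<close>)

lemma measure_arc:
  assumes "0 \<le> a" "a \<le> pi"
  shows "measure M (line_arc a z) = cdf M (z + a) - cdf M z + cdf M (z + a - pi)"
proof -
  have eq: "line_arc a z = {z<..z+a} \<union> {..z+a-pi}"
    by (auto simp: line_arc_def)
  have "measure M (line_arc a z) = measure M {z<..z+a} + measure M {..z+a-pi}"
    unfolding eq using assms by (intro finite_measure_Union) auto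
  also have "measure M {z<..z+a} = cdf M (z + a) - cdf M z"
    using assms cdf_diff_eq[of z "z+a"] by (cases "a = 0") auto
  finally show ?thesis by (simp add: cdf_def2)
qed

lemma continuous_cdf_shift:
  "continuous (at_right z) (\<lambda>x. cdf M (x + c))"
proof -
  have "((\<lambda>x. cdf M (x + c)) \<longlongrightarrow> cdf M (z + c)) (at_right z)"
  proof (rule filterlim_compose[where g = "cdf M"])
    show "(cdf M \<longlongrightarrow> cdf M (z + c)) (at_right (z + c))"
      using cdf_is_right_cont[of "z + c"] by (simp add: continuous_within)
    show "LIM x at_right z. x + c :> at_right (z + c)"
      by (auto simp: filterlim_at eventually_at_filter intro!: tendsto_eq_intros)
  qed
  then show ?thesis by (simp add: continuous_within)
qed

text \<open>For an arc that does not pass \<open>pi\<close> the hypothesis says that the distribution function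
grows by \<open>a / pi\<close> over length \<open>a\<close>, first for almost all \<open>z\<close> and \<open>a\<close> and then, by right
continuity in each variable, for all. Lengths are below \<open>pi/2\<close>, so \<open>x\<close> is reached from \<open>0\<close> in two
steps of \<open>x/2\<close>.\<close>

lemma uniform_cdf_of_arcs:
  assumes AE: "AE a in lborel. 0 < a \<longrightarrow> a < pi/2 \<longrightarrow>
      (AE z in lborel. 0 \<le> z \<longrightarrow> z < pi \<longrightarrow> measure M (line_arc a z) = a / pi)"
  shows "cdf M x = max 0 (min 1 (x / pi))"
proof -
  \<comment> \<open>Right continuity in the starting point \<open>z\<close>, then in the length \<open>a\<close>.\<close>
  have fixed_length: "cdf M (z + a) - cdf M z = a / pi"
    if a: "0 < a" "a < pi/2" and arcs: "AE z in lborel. 0 \<le> z \<longrightarrow> z < pi \<longrightarrow> measure M (line_arc a z) = a / pi"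
      and z: "0 \<le> z" "z < pi - a" for a z
  proof (rule right_continuous_AE_const[where l = 0 and r = "pi - a" and z = z
        and g = "\<lambda>z. cdf M (z + a) - cdf M z"])
    show "continuous (at_right z) (\<lambda>x. cdf M (x + a) - cdf M x)" for z
      using continuous_cdf_shift[of z a] continuous_cdf_shift[of z 0]
      by (auto intro!: continuous_intros)
    show "AE z in lborel. 0 < z \<longrightarrow> z < pi - a \<longrightarrow> cdf M (z + a) - cdf M z = a / pi"
      using arcs by eventually_elim (use a in \<open>auto simp: measure_arc cdf_nonpos\<close>)
  qed (use z in auto)
  have increments: "cdf M (z + a) = cdf M z + a / pi" if z: "0 \<le> z" and a: "0 \<le> a" "a < pi/2" "z + a < pi" for z a
  proof -
    have "cdf M (a + z) - a / pi = cdf M z"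
    proof (rule right_continuous_AE_const[where l = 0 and r = "min (pi/2) (pi - z)" and z = a
        and g = "\<lambda>a. cdf M (a + z) - a / pi"])
      show "continuous (at_right a) (\<lambda>a. cdf M (a + z) - a / pi)" for a
        by (intro continuous_intros continuous_cdf_shift) simp
      show "AE a in lborel. 0 < a \<longrightarrow> a < min (pi/2) (pi - z) \<longrightarrow> cdf M (a + z) - a / pi = cdf M z"
        using AE by eventually_elim (use z fixed_length in \<open>force simp: algebra_simps\<close>)
    qed (use a in auto)
    then show ?thesis by (simp add: add.commute)
  qed
  consider "x \<le> 0" | "pi \<le> x" | "0 < x" "x < pi" by linarith
  then show ?thesis
  proof cases
    case 1
    moreover from 1 have "x / pi \<le> 0" by (simp add: divide_nonpos_pos)
    ultimately show ?thesis by (simp add: cdf_nonpos)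
  next
    case 3
    have "cdf M x = cdf M (x/2) + x/2/pi"
      using increments[of "x/2" "x/2"] 3 by simp
    also have "cdf M (x/2) = x/2/pi"
      using increments[of 0 "x/2"] 3 by (simp add: cdf_nonpos)
    finally have "cdf M x = x / pi" by simp
    moreover have "0 \<le> x / pi" "x / pi \<le> 1" using 3 by auto
    ultimately show ?thesis by simp
  qed (simp add: cdf_ge_pi)
qed

lemma arcs_of_uniform_cdf:
  assumes cdf: "\<And>x. cdf M x = max 0 (min 1 (x / pi))"
    and a: "0 \<le> a" "a \<le> pi" and z: "0 \<le> z" "z \<le> pi"
  shows "measure M (line_arc a z) = a / pi"
proof (cases "z + a \<le> pi")
  case True
  then have "cdf M (z + a) = (z + a) / pi" "cdf M z = z / pi" "cdf M (z + a - pi) = 0"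
    using a z cdf_nonpos by (auto simp: cdf)
  then show ?thesis using a by (simp add: measure_arc field_simps)
next
  case False
  then have "cdf M (z + a) = 1" "cdf M z = z / pi" "cdf M (z + a - pi) = (z + a - pi) / pi"
    using a z cdf_ge_pi by (auto simp: cdf)
  then show ?thesis using a by (simp add: measure_arc field_simps)
qed

text \<open>Rotation by a quarter turn maps an arc of length \<open>pi/2\<close> onto its complement, so invariance
gives mass one half. Conversely, the distribution function then grows by one half over every
interval of length \<open>pi/2\<close>, and comparing \<open>(0, x]\<close> with its rotated copy shows that the rotated law
has the same distribution function.\<close>

lemma rot_invariant_iff_half_arcs:
  "distr M borel rot = M \<longleftrightarrow>
    (AE z in lborel. 0 \<le> z \<longrightarrow> z < pi \<longrightarrow> measure M (line_arc (pi/2) z) = 1/2)"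
proof
  assume inv: "distr M borel rot = M"
  have "measure M (line_arc (pi/2) z) = 1/2" if z: "0 \<le> z" "z < pi" for z
  proof -
    have "measure M (line_arc (pi/2) z) = measure (distr M borel rot) (line_arc (pi/2) z)"
      by (simp add: inv)
    also have "\<dots> = measure M (rot -` line_arc (pi/2) z)"
      by (subst measure_distr) auto
    also have "\<dots> = measure M (- line_arc (pi/2) z)"
      by (rule measure_eq_AE, use support in eventually_elim)
        (use z in \<open>auto simp: rot_def line_arc_def\<close>)
    also have "\<dots> = 1 - measure M (line_arc (pi/2) z)"
      using prob_compl[of "line_arc (pi/2) z"] by (simp add: Compl_eq_Diff_UNIV)
    finally show ?thesis by simp
  qed
  then show "AE z in lborel. 0 \<le> z \<longrightarrow> z < pi \<longrightarrow> measure M (line_arc (pi/2) z) = 1/2"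
    by auto
next
  assume AE: "AE z in lborel. 0 \<le> z \<longrightarrow> z < pi \<longrightarrow> measure M (line_arc (pi/2) z) = 1/2"
  have half: "cdf M (z + pi/2) = cdf M z + 1/2" if z: "0 \<le> z" "z \<le> pi/2" for z
  proof -
    have *: "cdf M (z + pi/2) - cdf M z = 1/2" if z: "0 \<le> z" "z < pi/2" for z
    proof (rule right_continuous_AE_const[where l = 0 and r = "pi/2" and z = z
        and g = "\<lambda>z. cdf M (z + pi/2) - cdf M z"])
      show "continuous (at_right z) (\<lambda>x. cdf M (x + pi/2) - cdf M x)" for z
        using continuous_cdf_shift[of z 0] by (auto intro!: continuous_intros continuous_cdf_shift)
      show "AE z in lborel. 0 < z \<longrightarrow> z < pi/2 \<longrightarrow> cdf M (z + pi/2) - cdf M z = 1/2"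
        using AE by eventually_elim (auto simp: measure_arc cdf_nonpos)
    qed (use z in auto)
    \<comment> \<open>The arc starting at \<open>pi/2\<close> is the complement of the one starting at \<open>0\<close>.\<close>
    show ?thesis
    proof (cases "z = pi/2")
      case True
      have "cdf M z = 1/2" unfolding True using *[of 0] by (simp add: cdf_nonpos)
      moreover have "z + pi/2 = pi" unfolding True by simp
      ultimately show ?thesis by (simp add: cdf_ge_pi)
    next
      case False
      then show ?thesis using *[of z] z by simp
    qed
  qed
  have half0: "cdf M (pi/2) = 1/2" using half[of 0] by (simp add: cdf_nonpos)
  interpret R: real_distribution "distr M borel rot"
    by (rule real_distribution_distr) simp
  have "cdf (distr M borel rot) x = cdf M x" for x
  proof -
    have eq: "cdf (distr M borel rot) x = measure M {u. rot u \<le> x}"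
      by (simp add: cdf_def2 measure_distr vimage_def)
    have by_AE: "measure M {u. rot u \<le> x} = measure M B"
      if "B \<in> sets borel" "\<And>u. 0 < u \<Longrightarrow> u \<le> pi \<Longrightarrow> rot u \<le> x \<longleftrightarrow> u \<in> B" for B
      by (rule measure_eq_AE, use support in eventually_elim) (use that in auto)
    consider "x \<le> 0" | "0 < x" "x \<le> pi/2" | "pi/2 < x" "x < pi" | "pi \<le> x" by linarith
    then show ?thesis
    proof cases
      case 1
      have "measure M {u. rot u \<le> x} = measure M {}"
        by (rule by_AE) (use 1 in \<open>auto simp: rot_def\<close>)
      then show ?thesis using 1 by (simp add: eq cdf_nonpos)
    next
      case 2
      have "measure M {u. rot u \<le> x} = measure M {pi/2<..x+pi/2}"
        by (rule by_AE) (use 2 in \<open>auto simp: rot_def\<close>)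
      also have "\<dots> = cdf M (x + pi/2) - cdf M (pi/2)"
        using 2 by (subst cdf_diff_eq) auto
      finally show ?thesis using half[of x] half0 2 by (simp add: eq)
    next
      case 3
      have "measure M {u. rot u \<le> x} = measure M ({..x-pi/2} \<union> {pi/2<..pi})"
        by (rule by_AE) (use 3 in \<open>auto simp: rot_def\<close>)
      also have "\<dots> = measure M {..x-pi/2} + measure M {pi/2<..pi}"
        using 3 by (intro finite_measure_Union) auto
      also have "\<dots> = cdf M (x - pi/2) + (cdf M pi - cdf M (pi/2))"
        by (subst cdf_diff_eq) (auto simp: cdf_def2)
      finally show ?thesis using half[of "x - pi/2"] half0 3 by (simp add: eq cdf_ge_pi)
    next
      case 4
      have "measure M {u. rot u \<le> x} = measure M UNIV"
        by (rule by_AE) (use 4 in \<open>auto simp: rot_def\<close>)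
      then show ?thesis using 4 prob_space by (simp add: eq cdf_ge_pi)
    qed
  qed
  then show "distr M borel rot = M"
    by (intro cdf_unique R.real_distribution_axioms real_distribution_axioms) auto
qed

end

section \<open>The kernels as mixtures of tents\<close>

text \<open>The distance of the kernel, as a function of \<open>t = theta x y\<close>, from its value at the right end
\<open>pi/2\<close>. It is nonnegative for every \<open>s\<close>, so energies become integrals in \<open>ennreal\<close>.\<close>

definition gap :: "real \<Rightarrow> real \<Rightarrow> ennreal" where
  "gap s t = (if s \<le> 0 \<and> t = 0 then \<infinity>
     else if s = 0 then ennreal (ln (pi/2) - ln t)
     else ennreal \<bar>t powr s - (pi/2) powr s\<bar>)"

text \<open>The remainder integral is evaluated with the antiderivative \<open>(x - t) * f' x - f x\<close>. At \<open>t = 0\<close>,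
where \<open>f\<close> may be singular, both sides are limits along \<open>b / (n + 1)\<close>, the right one by monotone
convergence; so \<open>G 0\<close> may be infinite.\<close>

lemma taylor_at_right_endpoint:
  fixes f f' w :: "real \<Rightarrow> real" and G :: "real \<Rightarrow> ennreal"
  assumes f: "\<And>x. 0 < x \<Longrightarrow> (f has_real_derivative f' x) (at x)"
    and f': "\<And>x. 0 < x \<Longrightarrow> (f' has_real_derivative w x) (at x)"
    and w [measurable]: "w \<in> borel_measurable borel" and w_nonneg: "\<And>x. 0 < x \<Longrightarrow> 0 \<le> w x"
    and b: "0 < b" "f' b \<le> 0"
    and G: "\<And>x. 0 < x \<Longrightarrow> x \<le> b \<Longrightarrow> G x = ennreal (f x - f b)"
    and G0: "(\<lambda>n. G (b / real (Suc n))) \<longlonglongrightarrow> G 0"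
    and t: "0 \<le> t" "t \<le> b"
  shows "G t = ennreal (- f' b * (b - t)) + (\<integral>\<^sup>+a. indicator {0<..<b} a * ennreal (w a * (a - t)) \<partial>lborel)"
    (is "_ = ?R t")
proof -
  have pos: "G t = ?R t" if t: "0 < t" "t \<le> b" for t
  proof -
    have "(\<integral>\<^sup>+a. indicator {0<..<b} a * ennreal (w a * (a - t)) \<partial>lborel)
      = (\<integral>\<^sup>+a. ennreal (w a * (a - t)) * indicator {t..b} a \<partial>lborel)"
    proof (rule nn_integral_cong_AE, use AE_lborel_singleton[of b] in eventually_elim)
      fix a :: real assume "a \<noteq> b"
      moreover have "ennreal (w a * (a - t)) = 0" if "0 < a" "a < t"
        using that w_nonneg[of a] by (intro ennreal_neg mult_nonneg_nonpos) auto
      ultimately show "indicator {0<..<b} a * ennreal (w a * (a - t)) = ennreal (w a * (a - t)) * indicator {t..b} a"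
        using t by (auto simp: indicator_def)
    qed
    also have "\<dots> = ennreal (((b - t) * f' b - f b) - ((t - t) * f' t - f t))"
    proof (rule nn_integral_FTC_Icc)
      fix x assume "x \<in> {t..b}"
      then show "((\<lambda>x. (x - t) * f' x - f x) has_real_derivative w x * (x - t)) (at x)" "0 \<le> w x * (x - t)"
        using t w_nonneg by (auto intro!: derivative_eq_intros f f')
    qed (use t in auto)
    finally have eq: "(\<integral>\<^sup>+a. indicator {0<..<b} a * ennreal (w a * (a - t)) \<partial>lborel) = ennreal ((b - t) * f' b - f b + f t)"
      by simp
    have "0 \<le> (b - t) * f' b - f b + f t"
    proof -
      have "(t - t) * f' t - f t \<le> (b - t) * f' b - f b"
      proof (rule DERIV_nonneg_imp_nondecreasing[where f = "\<lambda>x. (x - t) * f' x - f x"])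
        fix x assume "t \<le> x" "x \<le> b"
        then show "\<exists>y. ((\<lambda>x. (x - t) * f' x - f x) has_real_derivative y) (at x) \<and> 0 \<le> y"
          using t w_nonneg by (intro exI[of _ "w x * (x - t)"]) (auto intro!: derivative_eq_intros f f')
      qed (use t in auto)
      then show ?thesis by simp
    qed
    moreover have "0 \<le> - f' b * (b - t)" using b t by (simp add: mult_nonpos_nonneg)
    ultimately have "?R t = ennreal (- f' b * (b - t) + ((b - t) * f' b - f b + f t))"
      unfolding eq by (rule ennreal_plus[symmetric, rotated])
    then show ?thesis using t by (simp add: G algebra_simps)
  qed
  show ?thesis
  proof (cases "t = 0")
    case False
    then show ?thesis using pos t by simp
  next
    case True
    \<comment> \<open>The fractions \<open>b / (n + 1)\<close> stay in \<open>(0, b]\<close>, where the formula is already known.\<close>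
    let ?t = "\<lambda>n. b / real (Suc n)"
    have t0: "?t \<longlonglongrightarrow> 0" by real_asymp
    have tn: "0 < ?t n" "?t n \<le> b" for n using b by (auto simp: field_simps)
    have "(\<lambda>n. \<integral>\<^sup>+a. indicator {0<..<b} a * ennreal (w a * (a - ?t n)) \<partial>lborel)
        \<longlonglongrightarrow> (\<integral>\<^sup>+a. indicator {0<..<b} a * ennreal (w a * (a - 0)) \<partial>lborel)"
    proof (rule nn_integral_LIMSEQ)
      show "incseq (\<lambda>n a. indicator {0<..<b} a * ennreal (w a * (a - ?t n)))"
      proof (rule incseq_SucI, rule le_funI)
        fix n a
        have "?t (Suc n) \<le> ?t n" using b by (intro divide_left_mono) auto
        then show "indicator {0<..<b} a * ennreal (w a * (a - ?t n)) \<le> indicator {0<..<b} a * ennreal (w a * (a - ?t (Suc n)))"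
          using w_nonneg[of a] by (auto simp: indicator_def intro!: ennreal_leI mult_left_mono)
      qed
      show "(\<lambda>n. indicator {0<..<b} a * ennreal (w a * (a - ?t n)))
          \<longlonglongrightarrow> indicator {0<..<b} a * ennreal (w a * (a - 0))" for a
      proof (cases "a \<in> {0<..<b}")
        case True
        have "(\<lambda>n. ennreal (w a * (a - ?t n))) \<longlonglongrightarrow> ennreal (w a * (a - 0))"
          by (intro tendsto_ennrealI tendsto_mult tendsto_diff tendsto_const t0)
        then show ?thesis using True by simp
      qed simp
    qed measurable
    moreover have "(\<lambda>n. ennreal (- f' b * (b - ?t n))) \<longlonglongrightarrow> ennreal (- f' b * (b - 0))"
      by (intro tendsto_ennrealI tendsto_mult tendsto_diff tendsto_const t0)
    ultimately have "(\<lambda>n. ?R (?t n)) \<longlonglongrightarrow> ?R 0"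
      by (rule tendsto_add[rotated])
    moreover have "(\<lambda>n. ?R (?t n)) \<longlonglongrightarrow> G 0"
      using G0 pos tn by simp
    ultimately show ?thesis using True LIMSEQ_unique by blast
  qed
qed

text \<open>The integrand is a multiple of \<open>a powr s\<close>. This integral enters the energy of the uniform
law, and its finiteness is where \<open>-1 < s\<close> is used.\<close>

lemma powr_moment_finite:
  assumes "-1 < s"
  shows "(\<integral>\<^sup>+a. indicator {0<..<b} a * ennreal (c * a powr (s - 2) * a\<^sup>2) \<partial>lborel) < \<infinity>" 
proof (cases "0 < b")
  case b: True
  have "(\<integral>\<^sup>+a. indicator {0<..<b} a * ennreal (c * a powr (s - 2) * a\<^sup>2) \<partial>lborel)
     \<le> (\<integral>\<^sup>+a. ennreal \<bar>c\<bar> * (ennreal (a powr s) * indicator {0..b} a) \<partial>lborel)"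
  proof (rule nn_integral_mono)
    fix a :: real
    have "c * a powr (s - 2) * a\<^sup>2 \<le> \<bar>c\<bar> * a powr s" if "0 < a"
    proof -
      have "a powr (s - 2) * a\<^sup>2 = a powr s"
        using that by (simp add: powr_diff power2_eq_square)
      then show ?thesis by (simp add: mult.assoc mult_right_mono)
    qed
    then show "indicator {0<..<b} a * ennreal (c * a powr (s - 2) * a\<^sup>2) \<le> ennreal \<bar>c\<bar> * (ennreal (a powr s) * indicator {0..b} a)"
      by (auto simp: indicator_def ennreal_leI simp flip: ennreal_mult)
  qed
  also have "\<dots> = ennreal \<bar>c\<bar> * ennreal (b powr (s+1) / (s+1))"
  proof (subst nn_integral_cmult)
    show "ennreal \<bar>c\<bar> * (\<integral>\<^sup>+a. ennreal (a powr s) * indicator {0..b} a \<partial>lborel) = ennreal \<bar>c\<bar> * ennreal (b powr (s+1) / (s+1))"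
      using nn_integral_has_integral_lebesgue'[OF _ has_integral_powr_from_0[OF assms, of b]] b by simp
  qed auto
  also have "\<dots> < \<infinity>" by (simp add: ennreal_mult_less_top)
  finally show ?thesis .
qed simp

text \<open>The function expanded by Taylor's formula is \<open>t powr s\<close>, \<open>- ln t\<close> or \<open>- (t powr s)\<close>, according to
the sign of \<open>s\<close>; each is convex and decreasing. The density \<open>w\<close> is its second derivative and \<open>L\<close> is
minus its first derivative at \<open>pi/2\<close>.\<close>

lemma gap_tent_mixture:
  assumes s: "-1 < s" "s < 1"
  obtains w L where "w \<in> borel_measurable borel" "\<And>a. 0 < a \<Longrightarrow> 0 < w a" "0 \<le> L"
    "(\<integral>\<^sup>+a. indicator {0<..<pi/2} a * ennreal (w a * a\<^sup>2) \<partial>lborel) < \<infinity>"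
    "\<And>t. 0 \<le> t \<Longrightarrow> t \<le> pi/2 \<Longrightarrow> gap s t = ennreal (L * (pi/2 - t))
       + (\<integral>\<^sup>+a. indicator {0<..<pi/2} a * ennreal (w a * (a - t)) \<partial>lborel)"
proof -
  consider "s < 0" | "s = 0" | "0 < s" by linarith
  then show ?thesis
  proof cases
    case 1
    let ?f = "\<lambda>t. t powr s" and ?f' = "\<lambda>t. s * t powr (s - 1)" and ?w = "\<lambda>t. (s * (s - 1)) * t powr (s - 2)"
    have c: "0 < s * (s - 1)" using 1 by (simp add: mult_neg_neg)
    show thesis
    proof (rule that[of ?w "- ?f' (pi/2)"])
      fix t :: real assume t: "0 \<le> t" "t \<le> pi/2"
      show "gap s t = ennreal (- ?f' (pi/2) * (pi/2 - t)) + (\<integral>\<^sup>+a. indicator {0<..<pi/2} a * ennreal (?w a * (a - t)) \<partial>lborel)"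
      proof (rule taylor_at_right_endpoint[where f = ?f])
        show "gap s x = ennreal (x powr s - (pi/2) powr s)" if "0 < x" "x \<le> pi/2" for x
          using that 1 powr_mono2'[of s x "pi/2"] by (simp add: gap_def)
        have "filterlim (\<lambda>n. \<bar>(pi/2 / real (Suc n)) powr s - (pi/2) powr s\<bar>) at_top sequentially"
          using 1 by real_asymp
        then show "(\<lambda>n. gap s (pi/2 / real (Suc n))) \<longlonglongrightarrow> gap s 0"
          using 1 by (simp add: gap_def ennreal_tendsto_top_eq_at_top)
      qed (use 1 c t in \<open>auto intro!: derivative_eq_intros simp: mult_nonpos_nonneg\<close>)
    qed (use 1 c s powr_moment_finite[of s "pi/2" "s * (s - 1)"] in \<open>auto simp: mult_nonpos_nonneg\<close>)
  next
    case 2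
    let ?f = "\<lambda>t. - ln t" and ?f' = "\<lambda>t. - 1 / t" and ?w = "\<lambda>t. 1 * t powr (s - 2)"
    show thesis
    proof (rule that[of ?w "- ?f' (pi/2)"])
      fix t :: real assume t: "0 \<le> t" "t \<le> pi/2"
      show "gap s t = ennreal (- ?f' (pi/2) * (pi/2 - t)) + (\<integral>\<^sup>+a. indicator {0<..<pi/2} a * ennreal (?w a * (a - t)) \<partial>lborel)"
      proof (rule taylor_at_right_endpoint[where f = ?f])
        show "gap s x = ennreal (- ln x - - ln (pi/2))" if "0 < x" "x \<le> pi/2" for x
          using that 2 by (simp add: gap_def)
        have "filterlim (\<lambda>n. ln (pi/2) - ln (pi/2 / real (Suc n))) at_top sequentially"
          by real_asymp
        then show "(\<lambda>n. gap s (pi/2 / real (Suc n))) \<longlonglongrightarrow> gap s 0"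
          using 2 by (simp add: gap_def ennreal_tendsto_top_eq_at_top)
      qed (use 2 t in \<open>auto intro!: derivative_eq_intros simp: powr_minus powr_numeral field_simps power2_eq_square\<close>)
    qed (use 2 s powr_moment_finite[of s "pi/2" 1] in auto)
  next
    case 3
    let ?f = "\<lambda>t. - (t powr s)" and ?f' = "\<lambda>t. - (s * t powr (s - 1))" and ?w = "\<lambda>t. (s * (1 - s)) * t powr (s - 2)"
    have c: "0 < s * (1 - s)" using 3 s by simp
    show thesis
    proof (rule that[of ?w "- ?f' (pi/2)"])
      fix t :: real assume t: "0 \<le> t" "t \<le> pi/2"
      show "gap s t = ennreal (- ?f' (pi/2) * (pi/2 - t)) + (\<integral>\<^sup>+a. indicator {0<..<pi/2} a * ennreal (?w a * (a - t)) \<partial>lborel)"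
      proof (rule taylor_at_right_endpoint[where f = ?f])
        show "gap s x = ennreal (- (x powr s) - - ((pi/2) powr s))" if "0 < x" "x \<le> pi/2" for x
          using that 3 powr_mono2[of s x "pi/2"] by (simp add: gap_def)
        have "(\<lambda>n. \<bar>(pi/2 / real (Suc n)) powr s - (pi/2) powr s\<bar>) \<longlonglongrightarrow> \<bar>0 - (pi/2) powr s\<bar>"
          by (intro tendsto_intros, use 3 in real_asymp)
        then show "(\<lambda>n. gap s (pi/2 / real (Suc n))) \<longlonglongrightarrow> gap s 0"
          using 3 by (simp add: gap_def tendsto_ennrealI)
      qed (use 3 c t in \<open>auto intro!: derivative_eq_intros simp: algebra_simps\<close>)
    qed (use 3 c s powr_moment_finite[of s "pi/2" "s * (1 - s)"] in auto)
  qed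
qed

section \<open>Energies of angle laws\<close>

lemma arc_dist_range:
  "0 < u \<Longrightarrow> u \<le> pi \<Longrightarrow> 0 < v \<Longrightarrow> v \<le> pi \<Longrightarrow> arc_dist u v \<in> {0..pi/2}"
  by (auto simp: arc_dist_def min_def)

lemma gap_measurable [measurable]: "gap s \<in> borel_measurable borel"
  unfolding gap_def by measurable

context line_law
begin

lemma pair_energy_cong:
  assumes "\<And>t. 0 \<le> t \<Longrightarrow> t \<le> pi/2 \<Longrightarrow> K t = K' t"
  shows "pair_energy K M = pair_energy K' M"
  unfolding pair_energy_def
proof (rule nn_integral_cong_AE, use support in eventually_elim)
  case (elim v)
  show ?case
    by (rule nn_integral_cong_AE, use support in eventually_elim)
       (use elim arc_dist_range assms in auto)
qed

lemma pair_energy_add: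
  assumes [measurable]: "K \<in> borel_measurable borel" "K' \<in> borel_measurable borel"
  shows "pair_energy (\<lambda>t. K t + K' t) M = pair_energy K M + pair_energy K' M"
  unfolding pair_energy_def by (simp add: nn_integral_add)

lemma pair_energy_cmult:
  assumes [measurable]: "K \<in> borel_measurable borel"
  shows "pair_energy (\<lambda>t. c * K t) M = c * pair_energy K M"
  unfolding pair_energy_def by (simp add: nn_integral_cmult)

lemma pair_energy_mixture:
  assumes [measurable]: "(\<lambda>(a, t). K a t) \<in> borel_measurable (lborel \<Otimes>\<^sub>M borel)"
  shows "pair_energy (\<lambda>t. \<integral>\<^sup>+a. K a t \<partial>lborel) M = (\<integral>\<^sup>+a. pair_energy (K a) M \<partial>lborel)"
proof -
  interpret pair_sigma_finite lborel M ..
  have "pair_energy (\<lambda>t. \<integral>\<^sup>+a. K a t \<partial>lborel) M = (\<integral>\<^sup>+v. \<integral>\<^sup>+a. \<integral>\<^sup>+u. K a (arc_dist u v) \<partial>M \<partial>lborel \<partial>M)"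
    unfolding pair_energy_def by (intro nn_integral_cong Fubini') measurable
  also have "\<dots> = (\<integral>\<^sup>+a. \<integral>\<^sup>+v. \<integral>\<^sup>+u. K a (arc_dist u v) \<partial>M \<partial>M \<partial>lborel)"
    by (intro Fubini') measurable
  finally show ?thesis by (simp add: pair_energy_def)
qed

lemma arc_discrepancy_eq_0_iff:
  "arc_discrepancy a = 0 \<longleftrightarrow> (AE z in lborel. 0 \<le> z \<longrightarrow> z < pi \<longrightarrow> measure M (line_arc a z) = a / pi)"
  unfolding arc_discrepancy_def
  by (subst nn_integral_0_iff_AE) (auto simp: indicator_def ennreal_eq_0_iff intro!: AE_cong split: if_splits)

lemma measurable_tent_energy [measurable]:
  "(\<lambda>a. pair_energy (\<lambda>t. ennreal (a - t)) M) \<in> borel_measurable borel"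
  unfolding pair_energy_def by measurable

end

text \<open>Integrating the mixture of \<open>gap_tent_mixture\<close> turns the energy into a constant \<open>c\<close>, collected
from the terms \<open>a\<^sup>2 / pi\<close> of \<open>tent_energy\<close>, plus an integral of discrepancies with the positive
weight \<open>w\<close>. As \<open>c\<close> is finite, it cancels, and energy \<open>c\<close> forces the discrepancy to vanish for almost
every \<open>a\<close>.\<close>

lemma gap_energy_minimum:
  assumes s: "-1 < s" "s < 1"
  obtains c where "c < \<infinity>"
    "\<And>M. line_law M \<Longrightarrow> c \<le> pair_energy (gap s) M"
    "\<And>M. line_law M \<Longrightarrow> pair_energy (gap s) M = c \<longleftrightarrow> (\<forall>x. cdf M x = max 0 (min 1 (x / pi)))"
proof -
  obtain w L where w [measurable]: "w \<in> borel_measurable borel" and w_pos: "\<And>a. 0 < a \<Longrightarrow> 0 < w a" and L: "0 \<le> L"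
    and fin: "(\<integral>\<^sup>+a. indicator {0<..<pi/2} a * ennreal (w a * a\<^sup>2) \<partial>lborel) < \<infinity>"
    and rep: "\<And>t. 0 \<le> t \<Longrightarrow> t \<le> pi/2 \<Longrightarrow> gap s t = ennreal (L * (pi/2 - t))
       + (\<integral>\<^sup>+a. indicator {0<..<pi/2} a * ennreal (w a * (a - t)) \<partial>lborel)"
    using gap_tent_mixture[OF s] by blast
  define W where "W a = indicator {0<..<pi/2} a * ennreal (w a)" for a
  have W [measurable]: "W \<in> borel_measurable borel"
    unfolding W_def by measurable
  define c1 where "c1 = ennreal L * ennreal ((pi/2)\<^sup>2 / pi)"
  define c2 where "c2 = (\<integral>\<^sup>+a. W a * ennreal (a\<^sup>2 / pi) \<partial>lborel)"
  have c1_fin: "c1 < \<infinity>" by (simp add: c1_def ennreal_mult_less_top)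
  have "c2 = (\<integral>\<^sup>+a. ennreal (1/pi) * (indicator {0<..<pi/2} a * ennreal (w a * a\<^sup>2)) \<partial>lborel)"
    unfolding c2_def W_def
    by (intro nn_integral_cong) (auto simp: indicator_def less_imp_le[OF w_pos] simp flip: ennreal_mult)
  also have "\<dots> = ennreal (1/pi) * (\<integral>\<^sup>+a. indicator {0<..<pi/2} a * ennreal (w a * a\<^sup>2) \<partial>lborel)"
    by (rule nn_integral_cmult) measurable
  finally have c2_fin: "c2 < \<infinity>" using fin by (simp add: ennreal_mult_less_top)
  have energy: "pair_energy (gap s) M = ennreal L * pair_energy (\<lambda>t. ennreal (pi/2 - t)) M
       + (\<integral>\<^sup>+a. W a * pair_energy (\<lambda>t. ennreal (a - t)) M \<partial>lborel)" if "line_law M" for M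
  proof -
    interpret line_law M by fact
    have "pair_energy (gap s) M = pair_energy (\<lambda>t. ennreal L * ennreal (pi/2 - t)
        + (\<integral>\<^sup>+a. W a * ennreal (a - t) \<partial>lborel)) M"
    proof (rule pair_energy_cong)
      fix t :: real assume t: "0 \<le> t" "t \<le> pi/2"
      have "(\<integral>\<^sup>+a. indicator {0<..<pi/2} a * ennreal (w a * (a - t)) \<partial>lborel) = (\<integral>\<^sup>+a. W a * ennreal (a - t) \<partial>lborel)"
        by (intro nn_integral_cong) (auto simp: W_def indicator_def ennreal_mult' less_imp_le[OF w_pos])
      then show "gap s t = ennreal L * ennreal (pi/2 - t) + (\<integral>\<^sup>+a. W a * ennreal (a - t) \<partial>lborel)"
        using rep[OF t] L by (simp add: ennreal_mult')
    qed
    also have "\<dots> = ennreal L * pair_energy (\<lambda>t. ennreal (pi/2 - t)) M + (\<integral>\<^sup>+a. pair_energy (\<lambda>t. W a * ennreal (a - t)) M \<partial>lborel)"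
      by (simp add: pair_energy_add pair_energy_cmult pair_energy_mixture)
    finally show ?thesis by (simp add: pair_energy_cmult)
  qed
  \<comment> \<open>The truncated difference is a true one by \<open>tent_energy\<close>, and it is measurable in \<open>a\<close>.\<close>
  define D where "D M a = pair_energy (\<lambda>t. ennreal (a - t)) M - ennreal (a\<^sup>2 / pi)" for M a
  have D: "pair_energy (\<lambda>t. ennreal (a - t)) M = ennreal (a\<^sup>2 / pi) + D M a" "D M a = line_law.arc_discrepancy M a"
    if "line_law M" "0 \<le> a" "a \<le> pi/2" for M a
    using line_law.tent_energy[OF that] by (simp_all add: D_def)
  have split: "pair_energy (gap s) M = (c1 + c2) + (ennreal L * D M (pi/2) + (\<integral>\<^sup>+a. W a * D M a \<partial>lborel))" if M: "line_law M" for M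
  proof -
    interpret line_law M by fact
    have [measurable]: "D M \<in> borel_measurable borel"
      unfolding D_def by measurable
    have "(\<integral>\<^sup>+a. W a * pair_energy (\<lambda>t. ennreal (a - t)) M \<partial>lborel) = (\<integral>\<^sup>+a. W a * ennreal (a\<^sup>2 / pi) + W a * D M a \<partial>lborel)"
      by (intro nn_integral_cong) (auto simp: W_def D[OF M] indicator_def distrib_left)
    then show ?thesis
      by (simp add: energy[OF M] nn_integral_add c1_def c2_def D[OF M] distrib_left ac_simps)
  qed
  show thesis
  proof (rule that[of "c1 + c2"])
    show "c1 + c2 < \<infinity>" using c1_fin c2_fin by simp
    fix M assume M: "line_law M"
    then interpret line_law M .
    show "c1 + c2 \<le> pair_energy (gap s) M"
      by (simp add: split[OF M])
    have [measurable]: "D M \<in> borel_measurable borel"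
      unfolding D_def by measurable
    show "pair_energy (gap s) M = c1 + c2 \<longleftrightarrow> (\<forall>x. cdf M x = max 0 (min 1 (x / pi)))"
    proof
      assume "pair_energy (gap s) M = c1 + c2"
      then have "(\<integral>\<^sup>+a. W a * D M a \<partial>lborel) = 0"
        using c1_fin c2_fin unfolding split[OF M] by auto
      then have "AE a in lborel. W a * D M a = 0"
        by (subst (asm) nn_integral_0_iff_AE) auto
      then have "AE a in lborel. 0 < a \<longrightarrow> a < pi/2 \<longrightarrow> arc_discrepancy a = 0"
        by eventually_elim (auto simp: W_def D(2)[OF M] indicator_def dest: w_pos)
      then show "\<forall>x. cdf M x = max 0 (min 1 (x / pi))"
        using uniform_cdf_of_arcs by (simp add: arc_discrepancy_eq_0_iff)
    next
      assume cdf: "\<forall>x. cdf M x = max 0 (min 1 (x / pi))"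
      have "arc_discrepancy a = 0" if "0 \<le> a" "a \<le> pi/2" for a
        using that arcs_of_uniform_cdf cdf by (simp add: arc_discrepancy_eq_0_iff)
      then have "D M (pi/2) = 0" "(\<integral>\<^sup>+a. W a * D M a \<partial>lborel) = 0"
        by (auto simp: D(2)[OF M] W_def indicator_def intro!: nn_integral_zero')
      then show "pair_energy (gap s) M = c1 + c2"
        by (simp add: split[OF M])
    qed
  qed
qed

text \<open>Here \<open>gap 1\<close> is itself the tent of length \<open>pi/2\<close>.\<close>

lemma (in line_law) gap_1_energy:
  "ennreal (pi/4) \<le> pair_energy (gap 1) M"
  "pair_energy (gap 1) M = ennreal (pi/4) \<longleftrightarrow> distr M borel rot = M"
proof -
  have "pair_energy (gap 1) M = pair_energy (\<lambda>t. ennreal (pi/2 - t)) M"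
    by (rule pair_energy_cong) (auto simp: gap_def)
  also have "\<dots> = ennreal (pi/4) + arc_discrepancy (pi/2)"
    by (subst tent_energy) (auto simp: power2_eq_square)
  finally have eq: "pair_energy (gap 1) M = ennreal (pi/4) + arc_discrepancy (pi/2)" .
  show "ennreal (pi/4) \<le> pair_energy (gap 1) M"
    by (simp add: eq)
  show "pair_energy (gap 1) M = ennreal (pi/4) \<longleftrightarrow> distr M borel rot = M"
    by (simp add: eq rot_invariant_iff_half_arcs arc_discrepancy_eq_0_iff)
qed

section \<open>The angle of a line\<close>

definition dir :: "real \<Rightarrow> real^2" where
  "dir t = vector [cos t, sin t]"

text \<open>The inverse of \<open>dir\<close> on the representative in the upper half plane; the horizontal line gets
\<open>pi\<close>, so the values lie in \<open>(0, pi]\<close>.\<close>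

definition line_angle :: "real^2 \<Rightarrow> real" where
  "line_angle x = (if x$2 > 0 then arccos (x$1) else if x$2 < 0 then arccos (- x$1) else pi)"

lemma dir_nth [simp]: "dir t $ 1 = cos t" "dir t $ 2 = sin t"
  by (simp_all add: dir_def)

lemma circle_iff: "x \<in> circle \<longleftrightarrow> (x$1)\<^sup>2 + (x$2)\<^sup>2 = 1" for x :: "real^2"
  by (simp add: norm_vec_def L2_set_def sum_2)

lemma dir_in_circle [simp]: "dir t \<in> circle"
  unfolding circle_iff by simp

lemma norm_dir [simp]: "norm (dir t) = 1"
  using dir_in_circle[of t] by (simp del: dir_in_circle)

lemma dir_add_pi: "dir (t + pi) = - dir t"
  by (simp add: vec_eq_iff forall_2)

lemma inner_dir: "dir u \<bullet> dir v = cos (u - v)"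
  by (simp add: inner_vec_def sum_2 cos_diff)

lemma line_angle_dir:
  assumes "0 < t" "t \<le> pi" shows "line_angle (dir t) = t"
proof (cases "t = pi")
  case False
  then have "0 < sin t" using assms by (intro sin_gt_zero) auto
  then show ?thesis using assms by (simp add: line_angle_def arccos_cos)
qed (simp add: line_angle_def)

lemma line_angle_uminus [simp]: "line_angle (- x) = line_angle x"
  by (auto simp: line_angle_def)

lemma dir_line_angle_upper:
  assumes x: "x \<in> circle" and "x$2 > 0"
  shows "dir (line_angle x) = x" "0 < line_angle x" "line_angle x < pi"
proof -
  have sq: "(x$1)\<^sup>2 + (x$2)\<^sup>2 = 1" using x unfolding circle_iff .
  have "0 < (x$2)\<^sup>2" using \<open>x$2 > 0\<close> by simp
  then have "(x$1)\<^sup>2 < 1" using sq by linarith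
  then have lt: "\<bar>x$1\<bar> < 1" by (simp add: abs_square_less_1)
  have "sin (arccos (x$1)) = x$2"
    using lt sq \<open>x$2 > 0\<close> by (subst sin_arccos_abs) (auto intro!: real_sqrt_unique)
  then show "dir (line_angle x) = x"
    using lt \<open>x$2 > 0\<close> by (auto simp: vec_eq_iff forall_2 line_angle_def)
  show "0 < line_angle x" "line_angle x < pi"
    using arccos_lt_bounded[of "x$1"] lt \<open>x$2 > 0\<close> by (auto simp: line_angle_def)
qed

lemma line_angle_cases:
  assumes x: "x \<in> circle"
  obtains "0 < line_angle x" "line_angle x \<le> pi" "x = dir (line_angle x)"
    | "0 < line_angle x" "line_angle x \<le> pi" "x = - dir (line_angle x)"
proof -
  consider "x$2 > 0" | "(- x)$2 > 0" | "x$2 = 0" by fastforce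
  then show ?thesis
  proof cases
    case 1
    then show ?thesis using dir_line_angle_upper[OF x] that(1) by simp
  next
    case 2
    then show ?thesis using dir_line_angle_upper[of "-x"] x that(2) by (simp add: equation_minus_iff)
  next
    case 3
    then have "x$1 = 1 \<or> x$1 = -1" using x unfolding circle_iff by (simp add: power2_eq_1_iff)
    then show ?thesis
      using that 3 by (auto simp: line_angle_def vec_eq_iff forall_2)
  qed
qed

lemma line_angle_range: "x \<in> circle \<Longrightarrow> 0 < line_angle x \<and> line_angle x \<le> pi"
  by (metis line_angle_cases)

lemma theta_eq_arc_dist:
  assumes x: "x \<in> circle" and y: "y \<in> circle"
  shows "theta x y = arc_dist (line_angle x) (line_angle y)"
proof -
  define u v where "u = line_angle x" and "v = line_angle y"
  have uv: "0 < u" "u \<le> pi" "0 < v" "v \<le> pi"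
    using line_angle_range x y by (auto simp: u_def v_def)
  have "x = dir u \<or> x = - dir u" "y = dir v \<or> y = - dir v"
    using line_angle_cases[OF x] line_angle_cases[OF y] unfolding u_def v_def by metis+
  then have "\<bar>x \<bullet> y\<bar> = \<bar>cos (u - v)\<bar>"
    by (auto simp: inner_dir)
  also have "\<bar>cos (u - v)\<bar> = cos (arc_dist u v)"
  proof -
    have eq: "cos (u - v) = cos \<bar>u - v\<bar>" by simp
    show ?thesis
    proof (cases "\<bar>u - v\<bar> \<le> pi/2")
      case True
      then have "0 \<le> cos \<bar>u - v\<bar>" by (intro cos_ge_zero) linarith+
      then show ?thesis using True unfolding eq by (simp add: arc_dist_def min_def)
    next
      case False
      then have "0 \<le> cos (pi - \<bar>u - v\<bar>)" using uv by (intro cos_ge_zero) auto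
      then show ?thesis using False unfolding eq by (simp add: arc_dist_def min_def)
    qed
  qed
  finally have "theta x y = arccos (cos (arc_dist u v))"
    by (simp add: theta_def)
  also have "\<dots> = arc_dist u v"
    using arc_dist_range[OF uv] by (intro arccos_cos) auto
  finally show ?thesis by (simp add: u_def v_def)
qed

text \<open>With \<open>x = dir u\<close> or \<open>x = - dir u\<close> the right-hand side is \<open>sin u * sin (t - u)\<close>. The point of this form is that
it is an even polynomial in \<open>x\<close>: the sublevel sets of the angle are open and antipodally
symmetric, which gives measurability both on the circle and on the projective line.\<close>

lemma line_angle_less_iff:
  assumes x: "x \<in> circle" and t: "0 < t" "t \<le> pi"
  shows "line_angle x < t \<longleftrightarrow> 0 < x$2 * (sin t * x$1 - cos t * x$2)"
proof -
  define u where "u = line_angle x"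
  have u: "0 < u" "u \<le> pi" using line_angle_range[OF x] by (auto simp: u_def)
  have "x$2 * (sin t * x$1 - cos t * x$2) = sin u * sin (t - u)"
    using x by (rule line_angle_cases) (simp_all flip: u_def, simp_all add: sin_diff algebra_simps)
  also have "0 < \<dots> \<longleftrightarrow> u < t"
  proof (cases "u < t")
    case True
    then have "0 < sin u" "0 < sin (t - u)" using u t by (auto intro!: sin_gt_zero)
    then show ?thesis using True by simp
  next
    case False
    then have "0 \<le> sin u" "0 \<le> sin (u - t)" using u t by (auto intro!: sin_ge_zero)
    then have "0 \<le> sin u * sin (u - t)" by simp
    then have "sin u * sin (t - u) \<le> 0" using sin_minus[of "u - t"] by simp
    then show ?thesis using False by linarith
  qed
  finally show ?thesis by (simp add: u_def)
qed

lemma space_circle_borel [simp]: "space circle_borel = circle"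
  by (simp add: circle_borel_def space_restrict_space)

lemma open_line_angle_less:
  "openin (top_of_set circle) {x \<in> circle. line_angle x < t}"
proof -
  consider "t \<le> 0" | "pi < t" | "0 < t" "t \<le> pi" by linarith
  then show ?thesis
  proof cases
    case 1
    then have "{x \<in> circle. line_angle x < t} = {}" using line_angle_range by fastforce
    then show ?thesis by (simp only: openin_empty)
  next
    case 2
    then have "{x \<in> circle. line_angle x < t} = circle" using line_angle_range by fastforce
    then show ?thesis by (simp only: openin_subtopology_self)
  next
    case 3
    have "{x \<in> circle. line_angle x < t} = circle \<inter> {x. 0 < x$2 * (sin t * x$1 - cos t * x$2)}"
      using line_angle_less_iff[OF _ 3] by blast
    moreover have "open {x :: real^2. 0 < x$2 * (sin t * x$1 - cos t * x$2)}"
      by (intro open_Collect_less continuous_intros)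
    ultimately show ?thesis by (simp add: openin_open_Int)
  qed
qed

lemma openin_circle_sets: "openin (top_of_set circle) U \<Longrightarrow> U \<in> sets circle_borel"
  by (auto simp: openin_open circle_borel_def sets_restrict_space)

lemma line_angle_measurable [measurable]: "line_angle \<in> borel_measurable circle_borel"
  unfolding borel_measurable_iff_less
  using open_line_angle_less[THEN openin_circle_sets] by simp

lemma dir_measurable_borel [measurable]: "dir \<in> borel_measurable borel"
proof -
  have "dir = (\<lambda>t. \<chi> i. if i = 1 then cos t else sin t)"
    by (auto simp: fun_eq_iff vec_eq_iff forall_2)
  moreover have "continuous_on UNIV (\<lambda>t::real. if i = 1 then cos t else sin t)" for i :: 2
    using continuous_on_cos[OF continuous_on_id, of "UNIV :: real set"]
      continuous_on_sin[OF continuous_on_id, of "UNIV :: real set"]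
    by (cases "i = 1") simp_all
  then have "continuous_on UNIV (\<lambda>t::real. \<chi> i::2. if i = 1 then cos t else sin t)"
    by (rule continuous_on_vec_lambda)
  ultimately have "continuous_on UNIV dir" by (simp only:)
  then show ?thesis by (rule borel_measurable_continuous_onI)
qed

lemma dir_measurable [measurable]: "dir \<in> measurable borel circle_borel"
  unfolding circle_borel_def by (intro measurable_restrict_space2) auto

section \<open>Measures on the circle and their angle laws\<close>

text \<open>All energies and projective notions factor through this image measure on \<open>(0, pi]\<close>.\<close>

definition angle_law :: "(real^2) measure \<Rightarrow> real measure" where
  "angle_law \<mu> = distr \<mu> borel line_angle"

lemma circle_probsD:
  assumes "\<mu> \<in> circle_probs"
  shows "prob_space \<mu>" "sets \<mu> = sets circle_borel" "space \<mu> = circle"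
  using assms sets_eq_imp_space_eq[of \<mu> circle_borel] by (auto simp: circle_probs_def)

lemma line_angle_measurable':
  "\<mu> \<in> circle_probs \<Longrightarrow> line_angle \<in> borel_measurable \<mu>"
  using line_angle_measurable measurable_cong_sets[OF circle_probsD(2) refl] by blast

lemma line_law_angle_law:
  assumes \<mu>: "\<mu> \<in> circle_probs"
  shows "line_law (angle_law \<mu>)"
proof -
  note [measurable] = line_angle_measurable'[OF \<mu>]
  interpret prob_space \<mu> by (rule circle_probsD[OF \<mu>])
  interpret D: prob_space "angle_law \<mu>"
    unfolding angle_law_def by (rule prob_space_distr) measurable
  show ?thesis
  proof
    show "sets (angle_law \<mu>) = sets borel" by (simp add: angle_law_def)
    show "AE u in angle_law \<mu>. 0 < u \<and> u \<le> pi"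
      unfolding angle_law_def using line_angle_range
      by (subst AE_distr_iff) (auto simp: circle_probsD[OF \<mu>])
  qed
qed

lemma symmetrized_sets:
  assumes E: "E \<in> sets circle_borel"
  shows "E \<union> uminus ` E \<in> sets circle_borel"
proof -
  have E': "E \<in> sets borel" "E \<subseteq> circle"
    using E by (auto simp: circle_borel_def sets_restrict_space)
  have "uminus -` E \<inter> space borel \<in> sets borel"
    by (rule measurable_sets[OF _ E'(1)]) simp
  moreover have "uminus ` E = uminus -` E \<inter> space borel"
    by (force simp: image_iff)
  ultimately have "uminus ` E \<in> sets borel" by simp
  moreover have "uminus ` E \<subseteq> circle" using E'(2) by auto
  ultimately have "E \<union> uminus ` E = circle \<inter> (E \<union> uminus ` E)" "E \<union> uminus ` E \<in> sets borel"
    using E' by auto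
  then show ?thesis
    unfolding circle_borel_def sets_restrict_space by blast
qed

text \<open>The symmetric Borel sets \<open>E \<union> -E\<close> are the preimages of Borel sets of angles.\<close>

lemma proj_equal_iff_angle_law:
  assumes \<mu>: "\<mu> \<in> circle_probs" and \<nu>: "\<nu> \<in> circle_probs"
  shows "proj_equal \<mu> \<nu> \<longleftrightarrow> angle_law \<mu> = angle_law \<nu>"
proof
  assume eq: "proj_equal \<mu> \<nu>"
  show "angle_law \<mu> = angle_law \<nu>"
  proof (rule measure_eqI)
    fix B assume "B \<in> sets (angle_law \<mu>)"
    then have [measurable]: "B \<in> sets borel" by (simp add: angle_law_def)
    let ?E = "line_angle -` B \<inter> circle"
    have E: "?E \<in> sets circle_borel"
      using measurable_sets[OF line_angle_measurable \<open>B \<in> sets borel\<close>] by simp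
    have "?E \<union> uminus ` ?E = ?E" by auto
    then have "emeasure \<mu> ?E = emeasure \<nu> ?E"
      using eq E unfolding proj_equal_def by metis
    then show "emeasure (angle_law \<mu>) B = emeasure (angle_law \<nu>) B"
      using line_angle_measurable' \<mu> \<nu> by (simp add: angle_law_def emeasure_distr circle_probsD)
  qed (simp add: angle_law_def)
next
  assume eq: "angle_law \<mu> = angle_law \<nu>"
  show "proj_equal \<mu> \<nu>"
    unfolding proj_equal_def
  proof
    fix E assume "E \<in> sets circle_borel"
    define S where "S = E \<union> uminus ` E"
    have S: "S \<in> sets circle_borel"
      using symmetrized_sets[OF \<open>E \<in> _\<close>] by (simp add: S_def)
    have Sc: "S \<subseteq> circle"
      using sets.sets_into_space[OF S] by (simp only: space_circle_borel)
    have sym: "- x \<in> S \<longleftrightarrow> x \<in> S" for x by (force simp: S_def)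
    have B: "dir -` S \<in> sets borel"
      using measurable_sets[OF dir_measurable S] by simp
    have "S = line_angle -` (dir -` S) \<inter> circle"
    proof -
      have "x \<in> S \<longleftrightarrow> dir (line_angle x) \<in> S" if "x \<in> circle" for x
        using that by (rule line_angle_cases) (metis sym)+
      then show ?thesis using Sc by blast
    qed
    moreover have "emeasure \<mu> (line_angle -` (dir -` S) \<inter> circle) = emeasure (angle_law \<mu>) (dir -` S)"
       "emeasure \<nu> (line_angle -` (dir -` S) \<inter> circle) = emeasure (angle_law \<nu>) (dir -` S)"
      using B line_angle_measurable' \<mu> \<nu> by (simp_all add: angle_law_def emeasure_distr circle_probsD)
    ultimately show "emeasure \<mu> (E \<union> uminus ` E) = emeasure \<nu> (E \<union> uminus ` E)"
      using eq by (simp flip: S_def)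
  qed
qed

lemma uniform_circle_in_circle_probs: "uniform_circle \<in> circle_probs"
proof -
  interpret prob_space "uniform_measure lborel {0..<2*pi}"
    by (rule prob_space_uniform_measure) (auto simp: emeasure_lborel_atLeastLessThan)
  have "prob_space uniform_circle"
    unfolding uniform_circle_def dir_def[symmetric] by (rule prob_space_distr) measurable
  then show ?thesis by (simp add: circle_probs_def uniform_circle_def)
qed

text \<open>Every line is met twice by \<open>dir\<close> on \<open>[0, 2 pi)\<close>, so the angles up to \<open>x\<close> correspond to parameters
of total length \<open>2 x\<close>.\<close>

lemma cdf_uniform_circle: "cdf (angle_law uniform_circle) x = max 0 (min 1 (x / pi))"
proof -
  interpret line_law "angle_law uniform_circle"
    by (rule line_law_angle_law[OF uniform_circle_in_circle_probs])
  consider "x \<le> 0" | "pi \<le> x" | "0 < x" "x < pi" by linarith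
  then show ?thesis
  proof cases
    case 1
    moreover from 1 have "x / pi \<le> 0" by (simp add: divide_nonpos_pos)
    ultimately show ?thesis by (simp add: cdf_nonpos)
  next
    case 2
    then show ?thesis by (simp add: cdf_ge_pi)
  next
    case 3
    let ?U = "uniform_measure lborel {0..<2*pi}"
    have [measurable]: "dir \<in> measurable ?U circle_borel" by measurable
    have law: "angle_law uniform_circle = distr ?U borel (line_angle \<circ> dir)"
      unfolding angle_law_def uniform_circle_def dir_def[symmetric] by (rule distr_distr) measurable
    have "emeasure (angle_law uniform_circle) {..x} = emeasure ?U {t. line_angle (dir t) \<le> x}"
      unfolding law by (subst emeasure_distr) (auto simp: vimage_def)
    also have "\<dots> = emeasure lborel ({0..<2*pi} \<inter> {t. line_angle (dir t) \<le> x}) / emeasure lborel {0..<2*pi}"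
    proof (rule emeasure_uniform_measure)
      have "(line_angle \<circ> dir) -` {..x} \<inter> space borel \<in> sets borel"
        by (rule measurable_sets[OF measurable_comp[OF dir_measurable line_angle_measurable]]) simp
      then show "{t. line_angle (dir t) \<le> x} \<in> sets lborel" by (simp add: vimage_def)
    qed simp
    also have "{0..<2*pi} \<inter> {t. line_angle (dir t) \<le> x} = {0<..x} \<union> {pi<..pi+x}"
    proof -
      have upper: "line_angle (dir t) = t - pi" if "pi < t" "t < 2*pi" for t
        using that line_angle_dir[of "t - pi"] dir_add_pi[of "t - pi"] by simp
      have "line_angle (dir 0) = pi" by (simp add: line_angle_def)
      then have "t \<in> {0..<2*pi} \<inter> {t. line_angle (dir t) \<le> x} \<longleftrightarrow> t \<in> {0<..x} \<union> {pi<..pi+x}" for t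
        using 3 upper[of t] line_angle_dir[of t] 
        by (cases "t = 0"; cases "t \<le> pi") auto
      then show ?thesis by blast
    qed
    also have "emeasure lborel ({0<..x} \<union> {pi<..pi+x}) = ennreal (2 * x)"
      using 3 by (subst plus_emeasure[symmetric]) (auto simp flip: ennreal_plus)
    also have "ennreal (2 * x) / emeasure lborel {0..<2*pi} = ennreal (x / pi)"
      using 3 by (simp add: divide_ennreal)
    finally have "cdf (angle_law uniform_circle) x = x / pi"
      using 3 by (simp add: cdf_def2 measure_def)
    moreover have "0 \<le> x / pi" "x / pi \<le> 1" using 3 by auto
    ultimately show ?thesis by simp
  qed
qed

section \<open>The extended-real energy\<close>

text \<open>The parts \<open>P\<close> and \<open>N\<close> of \<open>f\<close> satisfy \<open>P + max 0 (- c) = h + max 0 c + N\<close> pointwise with \<open>N\<close> bounded.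
Integrating this identity avoids any subtraction of infinite quantities.\<close>

lemma ereal_integral_shift:
  assumes M: "prob_space M" and h [measurable]: "h \<in> borel_measurable M"
    and f: "\<And>x. x \<in> space M \<Longrightarrow> f x = ereal c + enn2ereal (h x)"
  shows "ereal_integral M f = ereal c + enn2ereal (\<integral>\<^sup>+x. h x \<partial>M)"
proof -
  interpret prob_space M by fact
  have const: "(\<integral>\<^sup>+x. k \<partial>M) = k" for k :: ennreal by (simp add: emeasure_space_1)
  let ?P = "\<integral>\<^sup>+x. e2ennreal (f x) \<partial>M" and ?N = "\<integral>\<^sup>+x. e2ennreal (- f x) \<partial>M"
  have e2: "e2ennreal (ereal r) = ennreal r" for r
    by (simp add: ennreal_def)
  have split: "e2ennreal (ereal c + enn2ereal y) + ennreal (- c)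
      = y + ennreal c + e2ennreal (- (ereal c + enn2ereal y))"
    and neg_le: "e2ennreal (- (ereal c + enn2ereal y)) \<le> ennreal (- c)" for y
  proof -
    have "e2ennreal (ereal c + enn2ereal y) + ennreal (- c)
      = y + ennreal c + e2ennreal (- (ereal c + enn2ereal y)) \<and>
      e2ennreal (- (ereal c + enn2ereal y)) \<le> ennreal (- c)"
    proof (cases y)
      case (real r)
      consider "0 \<le> c" | "c < 0" "0 \<le> c + r" | "c < 0" "c + r < 0" by linarith
      then show ?thesis
        using real by cases (simp_all add: enn2ereal_ennreal e2 ennreal_neg ennreal_leI flip: ennreal_plus)
    next
      case top
      then show ?thesis by (simp add: e2ennreal_neg)
    qed
    then show "e2ennreal (ereal c + enn2ereal y) + ennreal (- c)
      = y + ennreal c + e2ennreal (- (ereal c + enn2ereal y))"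
      "e2ennreal (- (ereal c + enn2ereal y)) \<le> ennreal (- c)" by auto
  qed
  have [measurable]: "(\<lambda>x. e2ennreal (ereal c + enn2ereal (h x))) \<in> borel_measurable M"
      "(\<lambda>x. e2ennreal (- (ereal c + enn2ereal (h x)))) \<in> borel_measurable M"
    by measurable
  have P: "?P = (\<integral>\<^sup>+x. e2ennreal (ereal c + enn2ereal (h x)) \<partial>M)"
    and N: "?N = (\<integral>\<^sup>+x. e2ennreal (- (ereal c + enn2ereal (h x))) \<partial>M)"
    by (auto intro!: nn_integral_cong simp: f)
  have "?P + ennreal (- c) = (\<integral>\<^sup>+x. e2ennreal (ereal c + enn2ereal (h x)) + ennreal (- c) \<partial>M)"
    unfolding P by (subst nn_integral_add) (auto simp: emeasure_space_1)
  also have "\<dots> = (\<integral>\<^sup>+x. h x + ennreal c + e2ennreal (- (ereal c + enn2ereal (h x))) \<partial>M)"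
    by (simp only: split)
  also have "\<dots> = (\<integral>\<^sup>+x. h x \<partial>M) + ennreal c + ?N"
    unfolding N by (subst nn_integral_add, simp, simp, subst nn_integral_add) (auto simp: emeasure_space_1)
  finally have sum: "?P + ennreal (- c) = (\<integral>\<^sup>+x. h x \<partial>M) + ennreal c + ?N" .
  have "?N \<le> (\<integral>\<^sup>+x. ennreal (- c) \<partial>M)"
    unfolding N by (intro nn_integral_mono neg_le)
  then have "?N \<le> ennreal (- c)" unfolding const .
  then obtain n where n: "?N = ennreal n" "0 \<le> n"
    using neq_top_trans[OF ennreal_neq_top] by (cases ?N) auto
  show ?thesis
  proof (cases "\<integral>\<^sup>+x. h x \<partial>M")
    case (real r)
    then have total: "?P + ennreal (- c) = ennreal (r + max 0 c + n)"
      using sum n by (cases "0 \<le> c") (auto simp: ennreal_neg max_def)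
    then obtain p where p: "?P = ennreal p" "0 \<le> p"
      by (cases ?P) auto
    have "ennreal (p + max 0 (- c)) = ennreal p + ennreal (- c)"
      using p by (cases "0 \<le> c") (auto simp: ennreal_neg max_def simp flip: ennreal_plus)
    also have "\<dots> = ennreal (r + max 0 c + n)"
      using total unfolding p .
    finally have "ennreal (p + max 0 (- c)) = ennreal (r + max 0 c + n)" .
    then have "p - n = c + r"
      using p n real by (subst (asm) ennreal_inj) auto
    then show ?thesis
      using p n real by (simp add: ereal_integral_def enn2ereal_ennreal)
  next
    case top
    then have "?P = top" using sum by (cases ?P) auto
    then show ?thesis
      using n top by (simp add: ereal_integral_def enn2ereal_ennreal)
  qed
qed

lemma ereal_integral_reflect:
  assumes M: "prob_space M" and h [measurable]: "h \<in> borel_measurable M"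
    and c: "0 \<le> c" and hc: "\<And>x. x \<in> space M \<Longrightarrow> h x \<le> ennreal c"
    and f: "\<And>x. x \<in> space M \<Longrightarrow> f x = ereal c - enn2ereal (h x)"
  shows "ereal_integral M f = ereal c - enn2ereal (\<integral>\<^sup>+x. h x \<partial>M)"
proof -
  interpret prob_space M by fact
  have const: "(\<integral>\<^sup>+x. k \<partial>M) = k" for k :: ennreal by (simp add: emeasure_space_1)
  have "(\<integral>\<^sup>+x. h x \<partial>M) \<le> (\<integral>\<^sup>+x. ennreal c \<partial>M)"
    by (intro nn_integral_mono hc)
  then have le: "(\<integral>\<^sup>+x. h x \<partial>M) \<le> ennreal c"
    unfolding const .
  have pos: "e2ennreal (ereal c - enn2ereal y) = ennreal c - y"
    and neg: "e2ennreal (- (ereal c - enn2ereal y)) = 0"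
    and sub: "enn2ereal (ennreal c - y) = ereal c - enn2ereal y" if y: "y \<le> ennreal c" for y
  proof -
    obtain r where r: "y = ennreal r" "0 \<le> r" "r \<le> c"
      using y c by (cases y) (auto simp: top_unique)
    show "e2ennreal (ereal c - enn2ereal y) = ennreal c - y"
      "e2ennreal (- (ereal c - enn2ereal y)) = 0"
      "enn2ereal (ennreal c - y) = ereal c - enn2ereal y"
      using r by (simp_all add: ennreal_minus enn2ereal_ennreal ennreal_neg)
  qed
  have "(\<integral>\<^sup>+x. e2ennreal (f x) \<partial>M) = (\<integral>\<^sup>+x. ennreal c - h x \<partial>M)"
    by (intro nn_integral_cong) (simp only: f pos[OF hc])
  also have "\<dots> = ennreal c - (\<integral>\<^sup>+x. h x \<partial>M)"
    using le hc by (subst nn_integral_diff) (auto simp: emeasure_space_1 top_unique)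
  finally have P: "(\<integral>\<^sup>+x. e2ennreal (f x) \<partial>M) = ennreal c - (\<integral>\<^sup>+x. h x \<partial>M)" .
  have "(\<integral>\<^sup>+x. e2ennreal (- f x) \<partial>M) = (\<integral>\<^sup>+x. 0 \<partial>M)"
    by (intro nn_integral_cong) (simp only: f neg[OF hc])
  then have N: "(\<integral>\<^sup>+x. e2ennreal (- f x) \<partial>M) = 0" by simp
  show ?thesis
    unfolding ereal_integral_def P N by (simp add: sub[OF le] zero_ennreal.rep_eq)
qed

text \<open>The value of the kernel at distance \<open>pi/2\<close>.\<close>

definition energy_base :: "real \<Rightarrow> real" where
  "energy_base s = (if s = 0 then - ln (pi/2) else (pi/2) powr s)"

lemma angle_kernel_gap:
  fixes s :: real and x y :: "real^2"
  assumes x: "x \<in> circle" and y: "y \<in> circle"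
  defines "g \<equiv> gap s (arc_dist (line_angle x) (line_angle y))"
  shows "s \<le> 0 \<Longrightarrow> angle_kernel s x y = ereal (energy_base s) + enn2ereal g"
    and "0 < s \<Longrightarrow> angle_kernel s x y = ereal (energy_base s) - enn2ereal g"
    and "0 < s \<Longrightarrow> g \<le> ennreal (energy_base s)"
proof -
  let ?t = "theta x y"
  have eq: "g = gap s ?t" by (simp only: g_def theta_eq_arc_dist[OF x y])
  have t: "0 \<le> ?t" "?t \<le> pi/2"
    using arc_dist_range line_angle_range[OF x] line_angle_range[OF y]
    unfolding theta_eq_arc_dist[OF x y] by auto
  show "angle_kernel s x y = ereal (energy_base s) + enn2ereal g" if s: "s \<le> 0"
  proof -
    consider "?t = 0" | "0 < ?t" "s = 0" | "0 < ?t" "s < 0" using t s by linarith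
    then show ?thesis
    proof cases
      case 1
      then show ?thesis using s by (simp add: eq gap_def angle_kernel_def)
    next
      case 2
      then have "ln ?t \<le> ln (pi/2)" using t by (subst ln_le_cancel_iff) auto
      then show ?thesis using 2 by (simp add: eq gap_def angle_kernel_def energy_base_def enn2ereal_ennreal)
    next
      case 3
      then have "(pi/2) powr s \<le> ?t powr s" using t by (intro powr_mono2') auto
      then show ?thesis using 3 by (simp add: eq gap_def angle_kernel_def energy_base_def enn2ereal_ennreal)
    qed
  qed
  assume s: "0 < s"
  have le: "?t powr s \<le> (pi/2) powr s" using s t by (intro powr_mono2) auto
  show "angle_kernel s x y = ereal (energy_base s) - enn2ereal g"
    using s le by (simp add: eq gap_def angle_kernel_def energy_base_def enn2ereal_ennreal)
  show "g \<le> ennreal (energy_base s)"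
    using s le by (simp add: eq gap_def energy_base_def ennreal_leI)
qed

lemma energy_eq_pair_energy:
  assumes \<mu>: "\<mu> \<in> circle_probs"
  shows "s \<le> 0 \<Longrightarrow> energy s \<mu> = ereal (energy_base s) + enn2ereal (pair_energy (gap s) (angle_law \<mu>))"
    and "0 < s \<Longrightarrow> energy s \<mu> = ereal (energy_base s) - enn2ereal (pair_energy (gap s) (angle_law \<mu>))"
    and "0 < s \<Longrightarrow> pair_energy (gap s) (angle_law \<mu>) \<le> ennreal (energy_base s)"
proof -
  interpret prob_space \<mu> by (rule circle_probsD[OF \<mu>])
  note [simp] = circle_probsD(3)[OF \<mu>]
  note la [measurable] = line_angle_measurable'[OF \<mu>]
  define g where "g x y = gap s (arc_dist (line_angle x) (line_angle y))" for x y
  interpret L: line_law "angle_law \<mu>" by (rule line_law_angle_law[OF \<mu>])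
  have g_meas [measurable]: "(\<lambda>(x, y). g x y) \<in> borel_measurable (\<mu> \<Otimes>\<^sub>M \<mu>)"
    unfolding g_def by measurable
  have g_meas' [measurable]: "(\<lambda>x. g x y) \<in> borel_measurable \<mu>" if "y \<in> circle" for y
    unfolding g_def by measurable
  have g_int [measurable]: "(\<lambda>y. \<integral>\<^sup>+x. g x y \<partial>\<mu>) \<in> borel_measurable \<mu>"
    by measurable
  have J: "pair_energy (gap s) (angle_law \<mu>) = (\<integral>\<^sup>+y. \<integral>\<^sup>+x. g x y \<partial>\<mu> \<partial>\<mu>)"
  proof -
    have transfer: "(\<integral>\<^sup>+u. F u \<partial>angle_law \<mu>) = (\<integral>\<^sup>+x. F (line_angle x) \<partial>\<mu>)"
      if "F \<in> borel_measurable borel" for F :: "real \<Rightarrow> ennreal"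
      unfolding angle_law_def using la that by (intro nn_integral_distr) simp_all
    have "pair_energy (gap s) (angle_law \<mu>)
        = (\<integral>\<^sup>+y. \<integral>\<^sup>+u. gap s (arc_dist u (line_angle y)) \<partial>angle_law \<mu> \<partial>\<mu>)"
      unfolding pair_energy_def by (rule transfer) measurable
    also have "\<dots> = (\<integral>\<^sup>+y. \<integral>\<^sup>+x. g x y \<partial>\<mu> \<partial>\<mu>)"
      unfolding g_def by (intro nn_integral_cong transfer) measurable
    finally show ?thesis .
  qed
  show "energy s \<mu> = ereal (energy_base s) + enn2ereal (pair_energy (gap s) (angle_law \<mu>))" if s: "s \<le> 0"
    unfolding energy_def J
  proof (rule ereal_integral_shift[OF prob_space_axioms g_int])
    fix y assume "y \<in> space \<mu>"
    then have y: "y \<in> circle" by simp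
    show "ereal_integral \<mu> (\<lambda>x. angle_kernel s x y) = ereal (energy_base s) + enn2ereal (\<integral>\<^sup>+x. g x y \<partial>\<mu>)"
      by (rule ereal_integral_shift[OF prob_space_axioms g_meas'[OF y]])
        (use y s angle_kernel_gap in \<open>auto simp: g_def\<close>)
  qed
  assume s: "0 < s"
  have base: "0 \<le> energy_base s" using s by (simp add: energy_base_def)
  have g_le: "g x y \<le> ennreal (energy_base s)" if "x \<in> space \<mu>" "y \<in> space \<mu>" for x y
    using that angle_kernel_gap(3)[of x y s] s by (simp add: g_def)
  have const: "(\<integral>\<^sup>+x. k \<partial>\<mu>) = k" for k :: ennreal
    using emeasure_space_1 by simp
  have int_le: "(\<integral>\<^sup>+x. g x y \<partial>\<mu>) \<le> ennreal (energy_base s)" if "y \<in> space \<mu>" for y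
  proof -
    have "(\<integral>\<^sup>+x. g x y \<partial>\<mu>) \<le> (\<integral>\<^sup>+x. ennreal (energy_base s) \<partial>\<mu>)"
      by (intro nn_integral_mono g_le that)
    then show ?thesis unfolding const .
  qed
  have "(\<integral>\<^sup>+y. \<integral>\<^sup>+x. g x y \<partial>\<mu> \<partial>\<mu>) \<le> (\<integral>\<^sup>+y. ennreal (energy_base s) \<partial>\<mu>)"
    by (intro nn_integral_mono int_le)
  then show "pair_energy (gap s) (angle_law \<mu>) \<le> ennreal (energy_base s)"
    unfolding const J .
  show "energy s \<mu> = ereal (energy_base s) - enn2ereal (pair_energy (gap s) (angle_law \<mu>))"
    unfolding energy_def J
  proof (rule ereal_integral_reflect[OF prob_space_axioms g_int base int_le])
    fix y assume y: "y \<in> space \<mu>"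
    then have y': "y \<in> circle" by simp
    show "ereal_integral \<mu> (\<lambda>x. angle_kernel s x y) = ereal (energy_base s) - enn2ereal (\<integral>\<^sup>+x. g x y \<partial>\<mu>)"
      by (rule ereal_integral_reflect[OF prob_space_axioms g_meas'[OF y'] base])
        (use y s g_le angle_kernel_gap in \<open>auto simp: g_def\<close>)
  qed
qed

text \<open>The energy is a strictly monotone function of the \<open>gap\<close> energy, increasing for \<open>s \<le> 0\<close> and
decreasing for \<open>s > 0\<close>. In the second case both values are finite.\<close>

lemma extremizers_eq:
  assumes min: "\<And>\<nu>. \<nu> \<in> circle_probs \<Longrightarrow> c \<le> pair_energy (gap s) (angle_law \<nu>)"
    and attained: "\<nu>\<^sub>0 \<in> circle_probs" "pair_energy (gap s) (angle_law \<nu>\<^sub>0) = c"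
  shows "s \<le> 0 \<Longrightarrow> minimizers s = {\<mu> \<in> circle_probs. pair_energy (gap s) (angle_law \<mu>) = c}"
    and "0 < s \<Longrightarrow> maximizers s = {\<mu> \<in> circle_probs. pair_energy (gap s) (angle_law \<mu>) = c}"
proof -
  let ?J = "\<lambda>\<mu>. pair_energy (gap s) (angle_law \<mu>)"
  have least: "(\<forall>\<nu>\<in>circle_probs. ?J \<mu> \<le> ?J \<nu>) \<longleftrightarrow> ?J \<mu> = c" if "\<mu> \<in> circle_probs" for \<mu>
    using min that attained by (auto intro: antisym)
  show "minimizers s = {\<mu> \<in> circle_probs. ?J \<mu> = c}" if s: "s \<le> 0"
  proof -
    have "energy s \<mu> \<le> energy s \<nu> \<longleftrightarrow> ?J \<mu> \<le> ?J \<nu>" if "\<mu> \<in> circle_probs" "\<nu> \<in> circle_probs" for \<mu> \<nu>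
      using that s by (simp add: energy_eq_pair_energy ereal_add_le_add_iff less_eq_ennreal.rep_eq)
    then show ?thesis unfolding minimizers_def using least by auto
  qed
  show "maximizers s = {\<mu> \<in> circle_probs. ?J \<mu> = c}" if s: "0 < s"
  proof -
    have "energy s \<nu> \<le> energy s \<mu> \<longleftrightarrow> ?J \<mu> \<le> ?J \<nu>" if "\<mu> \<in> circle_probs" "\<nu> \<in> circle_probs" for \<mu> \<nu>
    proof -
      have "?J \<mu> < \<infinity>" "?J \<nu> < \<infinity>"
        using energy_eq_pair_energy(3)[OF that(1) s] energy_eq_pair_energy(3)[OF that(2) s]
        by (auto intro: le_less_trans)
      then obtain a b where "?J \<mu> = ennreal a" "0 \<le> a" "?J \<nu> = ennreal b" "0 \<le> b"
        by (cases "?J \<mu>"; cases "?J \<nu>") auto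
      then show ?thesis
        using that s by (simp add: energy_eq_pair_energy enn2ereal_ennreal)
    qed
    then show ?thesis unfolding maximizers_def using least by auto
  qed
qed

section \<open>Orthogonal symmetry\<close>

lemma rot_range: "0 < u \<Longrightarrow> u \<le> pi \<Longrightarrow> 0 < rot u \<and> rot u \<le> pi"
  by (auto simp: rot_def)

lemma rot_rot: "0 < u \<Longrightarrow> u \<le> pi \<Longrightarrow> rot (rot u) = u"
  by (auto simp: rot_def)

lemma dir_perp_rot: "dir u \<bullet> dir (rot u) = 0"
  by (simp add: inner_dir rot_def)

text \<open>The inner product is \<open>cos (u - v)\<close> up to sign, and \<open>\<bar>u - v\<bar> < pi\<close>.\<close>

lemma orthogonal_line_angles:
  assumes x: "x \<in> circle" and y: "y \<in> circle"
  shows "x \<bullet> y = 0 \<longleftrightarrow> line_angle y = rot (line_angle x)"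
proof -
  define u v where "u = line_angle x" and "v = line_angle y"
  have uv: "0 < u" "u \<le> pi" "0 < v" "v \<le> pi"
    using line_angle_range x y by (auto simp: u_def v_def)
  have "x = dir u \<or> x = - dir u" "y = dir v \<or> y = - dir v"
    using line_angle_cases[OF x] line_angle_cases[OF y] unfolding u_def v_def by metis+
  then have "x \<bullet> y = 0 \<longleftrightarrow> cos \<bar>u - v\<bar> = cos (pi/2)"
    by (auto simp: inner_dir)
  also have "\<dots> \<longleftrightarrow> \<bar>u - v\<bar> = pi/2"
  proof
    assume "cos \<bar>u - v\<bar> = cos (pi/2)"
    then show "\<bar>u - v\<bar> = pi/2"
      by (rule cos_inj_pi[rotated -1]) (use uv in linarith)+
  qed (simp only:)
  also have "\<dots> \<longleftrightarrow> v = rot u"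
    using uv by (cases "u \<le> pi/2"; cases "u < v") (auto simp: abs_if rot_def)
  finally show ?thesis by (simp add: u_def v_def)
qed

lemma proj_eq_iff: "proj x = proj y \<longleftrightarrow> y = x \<or> y = - x"
  by (auto simp: proj_def doubleton_eq_iff)

lemma proj_dir_line_angle: "x \<in> circle \<Longrightarrow> proj (dir (line_angle x)) = proj x"
  by (elim line_angle_cases) (metis proj_eq_iff)+

lemma proj_in_RP1 [simp]: "x \<in> circle \<Longrightarrow> proj x \<in> RP1"
  by (simp only: RP1_def imageI)

lemma space_RP1_borel [simp]: "space RP1_borel = RP1"
  unfolding RP1_borel_def by (rule space_measure_of) auto

lemma open_RP1_sets:
  "U \<subseteq> RP1 \<Longrightarrow> openin (top_of_set circle) {x \<in> circle. proj x \<in> U} \<Longrightarrow> U \<in> sets RP1_borel"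
  unfolding RP1_borel_def by (subst sets_measure_of) auto

lemma proj_measurable [measurable]: "proj \<in> measurable circle_borel RP1_borel"
  unfolding RP1_borel_def
proof (rule measurable_measure_of)
  fix U assume "U \<in> {U. U \<subseteq> RP1 \<and> openin (top_of_set circle) {x \<in> circle. proj x \<in> U}}"
  then have "{x \<in> circle. proj x \<in> U} \<in> sets circle_borel"
    using openin_circle_sets by blast
  moreover have "proj -` U \<inter> space circle_borel = {x \<in> circle. proj x \<in> U}" by auto
  ultimately show "proj -` U \<inter> space circle_borel \<in> sets circle_borel" by simp
qed (auto simp only: space_circle_borel proj_in_RP1 mem_Collect_eq)

text \<open>The angle as a function on the projective line; any representative gives the same value.\<close>

definition RP1_angle :: "(real^2) set \<Rightarrow> real" where
  "RP1_angle l = line_angle (SOME x. x \<in> l)"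

lemma RP1_angle_proj [simp]: "RP1_angle (proj x) = line_angle x"
proof -
  have "(SOME y. y \<in> proj x) \<in> proj x"
    by (rule someI[of _ x]) (simp add: proj_def)
  then show ?thesis unfolding RP1_angle_def by (auto simp: proj_def)
qed

text \<open>The sublevel sets belong to the generator of \<open>RP1_borel\<close>, by \<open>open_line_angle_less\<close>.\<close>

lemma RP1_angle_measurable [measurable]: "RP1_angle \<in> borel_measurable RP1_borel"
  unfolding borel_measurable_iff_less
proof
  fix t
  show "{l \<in> space RP1_borel. RP1_angle l < t} \<in> sets RP1_borel"
  proof (rule open_RP1_sets)
    have "{x \<in> circle. proj x \<in> {l \<in> space RP1_borel. RP1_angle l < t}} = {x \<in> circle. line_angle x < t}"
      using proj_in_RP1 by auto
    then show "openin (top_of_set circle) {x \<in> circle. proj x \<in> {l \<in> space RP1_borel. RP1_angle l < t}}"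
      using open_line_angle_less by (simp only:)
  qed auto
qed

lemma proj_in_perp_iff:
  assumes x: "x \<in> circle" and E: "E \<subseteq> RP1"
  shows "proj x \<in> perp E \<longleftrightarrow> proj (dir (rot (line_angle x))) \<in> E"
proof -
  have orth: "(\<forall>a\<in>proj x. \<forall>b\<in>proj y. a \<bullet> b = 0) \<longleftrightarrow> x \<bullet> y = 0" for y
    by (auto simp: proj_def)
  define v where "v = rot (line_angle x)"
  have v: "0 < v" "v \<le> pi"
    using rot_range line_angle_range[OF x] by (auto simp: v_def)
  have "proj x \<in> perp E \<longleftrightarrow> (\<exists>m\<in>E. \<forall>a\<in>proj x. \<forall>b\<in>m. a \<bullet> b = 0)"
    using proj_in_RP1[OF x] by (simp only: perp_def mem_Collect_eq simp_thms)
  also have "\<dots> \<longleftrightarrow> (\<exists>y\<in>circle. proj y \<in> E \<and> x \<bullet> y = 0)"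
  proof
    assume "\<exists>m\<in>E. \<forall>a\<in>proj x. \<forall>b\<in>m. a \<bullet> b = 0"
    then obtain m where m: "m \<in> E" "\<forall>a\<in>proj x. \<forall>b\<in>m. a \<bullet> b = 0" by (rule bexE)
    obtain y where y: "m = proj y" "y \<in> circle"
      using E m(1) unfolding RP1_def by (rule imageE[OF subsetD])
    show "\<exists>y\<in>circle. proj y \<in> E \<and> x \<bullet> y = 0"
      by (rule bexI[OF _ y(2)]) (use m orth y(1) in simp)
  next
    assume "\<exists>y\<in>circle. proj y \<in> E \<and> x \<bullet> y = 0"
    then obtain y where "proj y \<in> E" "x \<bullet> y = 0" by (elim bexE conjE)
    then show "\<exists>m\<in>E. \<forall>a\<in>proj x. \<forall>b\<in>m. a \<bullet> b = 0"
      using orth[of y] by (intro bexI[of _ "proj y"]) simp_all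
  qed
  also have "\<dots> \<longleftrightarrow> proj (dir v) \<in> E"
  proof
    assume "\<exists>y\<in>circle. proj y \<in> E \<and> x \<bullet> y = 0"
    then obtain y where y: "y \<in> circle" "proj y \<in> E" "x \<bullet> y = 0" by (elim bexE conjE)
    then have "line_angle y = v"
      using orthogonal_line_angles[OF x y(1)] by (simp add: v_def)
    then show "proj (dir v) \<in> E"
      using proj_dir_line_angle[OF y(1)] y(2) by simp
  next
    assume "proj (dir v) \<in> E"
    then show "\<exists>y\<in>circle. proj y \<in> E \<and> x \<bullet> y = 0"
      using orthogonal_line_angles[OF x dir_in_circle[of v]] line_angle_dir[OF v]
      by (intro bexI[OF _ dir_in_circle[of v]]) (simp add: v_def)
  qed
  finally show ?thesis by (simp add: v_def)
qed

text \<open>Measurable sets of lines correspond to Borel sets of angles, and \<open>perp E\<close> corresponds to the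
preimage under \<open>rot\<close>. This also shows that \<open>perp E\<close> is measurable, so that its measure is not the
default value \<open>0\<close>.\<close>

lemma orthogonally_symmetric_iff:
  assumes \<mu>: "\<mu> \<in> circle_probs"
  shows "orthogonally_symmetric \<mu> \<longleftrightarrow> distr (angle_law \<mu>) borel rot = angle_law \<mu>"
proof -
  interpret L: line_law "angle_law \<mu>" by (rule line_law_angle_law[OF \<mu>])
  note la [measurable] = line_angle_measurable'[OF \<mu>]
  have proj_\<mu>: "proj \<in> measurable \<mu> RP1_borel"
    using proj_measurable measurable_cong_sets[OF circle_probsD(2)[OF \<mu>] refl] by blast
  have dist: "emeasure (distr \<mu> RP1_borel proj) F = emeasure (angle_law \<mu>) B"
    if F: "F \<in> sets RP1_borel" and B: "B \<in> sets borel"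
      and FB: "\<And>x. x \<in> circle \<Longrightarrow> proj x \<in> F \<longleftrightarrow> line_angle x \<in> B" for F B
  proof -
    have "emeasure (distr \<mu> RP1_borel proj) F = emeasure \<mu> (proj -` F \<inter> circle)"
      using F by (simp add: emeasure_distr[OF proj_\<mu>] circle_probsD[OF \<mu>])
    also have "proj -` F \<inter> circle = line_angle -` B \<inter> circle"
      using FB by blast
    also have "emeasure \<mu> \<dots> = emeasure (angle_law \<mu>) B"
      using B by (simp add: angle_law_def emeasure_distr[OF la] circle_probsD[OF \<mu>])
    finally show ?thesis .
  qed
  have rot_sets: "rot -` B \<in> sets borel" if "B \<in> sets borel" for B
    using measurable_sets[OF rot_measurable that] by simp
  have perp_symmetric: "emeasure (distr \<mu> RP1_borel proj) (perp E) = emeasure (angle_law \<mu>) (rot -` B)"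
    if E: "E \<in> sets RP1_borel" and B: "B \<in> sets borel"
      and EB: "\<And>x. x \<in> circle \<Longrightarrow> proj x \<in> E \<longleftrightarrow> line_angle x \<in> B" for E B
  proof (rule dist)
    have sub: "E \<subseteq> RP1" using sets.sets_into_space[OF E] by simp
    show perp: "proj x \<in> perp E \<longleftrightarrow> line_angle x \<in> rot -` B" if x: "x \<in> circle" for x
      using proj_in_perp_iff[OF x sub] EB[OF dir_in_circle] line_angle_dir
        rot_range[of "line_angle x"] line_angle_range[OF x] by simp
    have "perp E = RP1_angle -` (rot -` B) \<inter> space RP1_borel"
    proof (rule set_eqI)
      fix l
      show "l \<in> perp E \<longleftrightarrow> l \<in> RP1_angle -` (rot -` B) \<inter> space RP1_borel"
      proof (cases "l \<in> RP1")
        case True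
        then obtain x where x: "l = proj x" "x \<in> circle" unfolding RP1_def by (rule imageE)
        show ?thesis unfolding x(1) using perp[OF x(2)] proj_in_RP1[OF x(2)] by simp
      next
        case False
        then show ?thesis by (simp add: perp_def)
      qed
    qed
    then show "perp E \<in> sets RP1_borel"
      using measurable_sets[OF RP1_angle_measurable rot_sets[OF B]] by simp
  qed (rule rot_sets[OF B])
  have law_rot: "emeasure (distr (angle_law \<mu>) borel rot) B = emeasure (angle_law \<mu>) (rot -` B)"
    if "B \<in> sets borel" for B
    using that by (subst emeasure_distr) auto
  show ?thesis
  proof
    assume sym: "orthogonally_symmetric \<mu>"
    show "distr (angle_law \<mu>) borel rot = angle_law \<mu>"
    proof (rule measure_eqI)
      fix B assume "B \<in> sets (distr (angle_law \<mu>) borel rot)"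
      then have B: "B \<in> sets borel" by simp
      define E where "E = RP1_angle -` B \<inter> space RP1_borel"
      have E: "E \<in> sets RP1_borel" unfolding E_def by (rule measurable_sets[OF RP1_angle_measurable B])
      have EB: "proj x \<in> E \<longleftrightarrow> line_angle x \<in> B" if "x \<in> circle" for x
        using proj_in_RP1[OF that] by (simp add: E_def)
      have "emeasure (distr (angle_law \<mu>) borel rot) B = emeasure (distr \<mu> RP1_borel proj) (perp E)"
        by (simp only: law_rot[OF B] perp_symmetric[OF E B EB])
      also have "\<dots> = emeasure (distr \<mu> RP1_borel proj) E"
        using bspec[OF sym[unfolded orthogonally_symmetric_def] E] by (rule HOL.sym)
      also have "\<dots> = emeasure (angle_law \<mu>) B"
        by (rule dist[OF E B EB])
      finally show "emeasure (distr (angle_law \<mu>) borel rot) B = emeasure (angle_law \<mu>) B" .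
    qed simp
  next
    assume inv: "distr (angle_law \<mu>) borel rot = angle_law \<mu>"
    show "orthogonally_symmetric \<mu>"
      unfolding orthogonally_symmetric_def
    proof
      fix E assume E: "E \<in> sets RP1_borel"
      let ?B = "(\<lambda>u. proj (dir u)) -` E"
      have "(\<lambda>u. proj (dir u)) -` E \<inter> space borel \<in> sets borel"
        by (rule measurable_sets[OF _ E]) measurable
      then have B: "?B \<in> sets borel" by simp
      have EB: "proj x \<in> E \<longleftrightarrow> line_angle x \<in> ?B" if "x \<in> circle" for x
        using proj_dir_line_angle[OF that] by simp
      show "emeasure (distr \<mu> RP1_borel proj) E = emeasure (distr \<mu> RP1_borel proj) (perp E)"
        using law_rot[OF B] unfolding inv
        by (simp only: dist[OF E B EB] perp_symmetric[OF E B EB])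
    qed
  qed
qed

section \<open>Exponents above one\<close>

definition two_point_law :: "real \<Rightarrow> real measure \<Rightarrow> bool" where
  "two_point_law p M \<longleftrightarrow> (\<forall>B\<in>sets borel. emeasure M B = (indicator B p + indicator B (rot p)) / 2)"

lemma ennreal_inverse_2: "inverse 2 = ennreal (1/2)"
  using inverse_ennreal[of 2] by (simp add: inverse_eq_divide)

lemma ennreal_half_add_half: "inverse 2 + inverse 2 = (1::ennreal)"
  unfolding ennreal_inverse_2 by (subst ennreal_plus[symmetric]) auto

lemma ennreal_half:
  assumes "x + x = 1" shows "x = inverse (2::ennreal)"
proof (cases x)
  case (real r)
  then have "ennreal (r + r) = ennreal 1" using assms real by (simp only: ennreal_plus ennreal_1)
  then have "r + r = 1" using real by (simp only: ennreal_inj add_nonneg_nonneg zero_le_one)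
  then have "r = 1/2" by simp
  then show ?thesis unfolding real ennreal_inverse_2 by (rule arg_cong)
qed (use assms in simp)

text \<open>Invariance makes the masses of the two points equal, and together they carry all the mass.\<close>

lemma (in line_law) two_point_law_iff:
  assumes p: "0 < p" "p \<le> pi"
  shows "two_point_law p M \<longleftrightarrow> distr M borel rot = M \<and> (AE u in M. u = p \<or> u = rot p)"
proof
  assume two: "two_point_law p M"
  have "distr M borel rot = M"
  proof (rule measure_eqI)
    fix B assume "B \<in> sets (distr M borel rot)"
    then have B: "B \<in> sets borel" "rot -` B \<in> sets borel"
      using measurable_sets[OF rot_measurable] by auto
    then show "emeasure (distr M borel rot) B = emeasure M B"
      using two p by (simp add: emeasure_distr two_point_law_def rot_rot indicator_def add.commute)
  qed simp
  moreover have "AE u in M. u = p \<or> u = rot p"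
  proof (rule AE_I)
    show "emeasure M (- {p, rot p}) = 0"
      using two by (simp add: two_point_law_def)
  qed auto
  ultimately show "distr M borel rot = M \<and> (AE u in M. u = p \<or> u = rot p)" ..
next
  assume "distr M borel rot = M \<and> (AE u in M. u = p \<or> u = rot p)"
  then have inv: "distr M borel rot = M" and AE: "AE u in M. u = p \<or> u = rot p" by auto
  have ne: "p \<noteq> rot p" by (simp add: rot_def)
  have "emeasure M {rot p} = emeasure (distr M borel rot) {rot p}" by (simp add: inv)
  also have "\<dots> = emeasure M (rot -` {rot p})" by (simp add: emeasure_distr)
  also have "\<dots> = emeasure M {p}"
  proof (rule emeasure_eq_AE, use support in eventually_elim)
    case (elim u)
    then show ?case using p rot_rot by (metis singleton_iff vimage_singleton_eq)
  qed (use measurable_sets[OF rot_measurable, of "{rot p}"] in auto)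
  finally have same: "emeasure M {rot p} = emeasure M {p}" .
  have "emeasure M {p} + emeasure M {rot p} = emeasure M {p, rot p}"
    using ne by (subst plus_emeasure) (auto simp: insert_commute)
  also have "\<dots> = 1"
    using AE by (subst emeasure_eq_1_AE) auto
  finally have half: "emeasure M {p} = inverse 2" "emeasure M {rot p} = inverse 2"
    unfolding same by (simp_all add: same ennreal_half)
  show "two_point_law p M"
    unfolding two_point_law_def
  proof
    fix B :: "real set" assume B: "B \<in> sets borel"
    have "emeasure M B = emeasure M (B \<inter> {p} \<union> B \<inter> {rot p})"
      by (rule emeasure_eq_AE, use AE in eventually_elim) (use B in auto)
    also have "\<dots> = emeasure M (B \<inter> {p}) + emeasure M (B \<inter> {rot p})"
      using B ne by (subst plus_emeasure) auto
    also have "\<dots> = (indicator B p + indicator B (rot p)) / 2"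
      by (cases "p \<in> B"; cases "rot p \<in> B")
        (auto simp: half ennreal_half_add_half ennreal_half_add_half[folded mult_2] divide_ennreal_def)
    finally show "emeasure M B = (indicator B p + indicator B (rot p)) / 2" .
  qed
qed

context
  fixes e1 e2 :: "real^2"
  assumes onb: "orthonormal_basis e1 e2"
begin

lemma onb_in_circle: "e1 \<in> circle" "e2 \<in> circle"
  using onb by (auto simp: orthonormal_basis_def)

lemma sets_mu_onb: "sets (mu_onb e1 e2) = sets circle_borel"
  unfolding mu_onb_def using sets.sets_into_space[of _ circle_borel] sets.sigma_sets_eq[of circle_borel]
  by (subst sets_measure_of) auto

lemma emeasure_mu_onb:
  assumes E: "E \<in> sets circle_borel"
  shows "emeasure (mu_onb e1 e2) E = (indicator E e1 + indicator E e2) / 2"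
proof -
  let ?R = "\<lambda>e E. emeasure (return circle_borel e) E"
  have "emeasure (mu_onb e1 e2) E = (?R e1 E + ?R e2 E) / 2"
  proof (rule emeasure_measure_of[OF mu_onb_def])
    show "sets circle_borel \<subseteq> Pow circle"
      using sets.sets_into_space[of _ circle_borel] by auto
    show "positive (sets (mu_onb e1 e2)) (\<lambda>E. (?R e1 E + ?R e2 E) / 2)"
      by (simp add: positive_def)
    show "countably_additive (sets (mu_onb e1 e2)) (\<lambda>E. (?R e1 E + ?R e2 E) / 2)"
    proof (rule countably_additiveI)
      fix A :: "nat \<Rightarrow> (real^2) set"
      assume A: "range A \<subseteq> sets (mu_onb e1 e2)" "disjoint_family A"
      have "(\<Sum>i. ?R e (A i)) = ?R e (\<Union>i. A i)" for e
        using A by (intro suminf_emeasure) (auto simp: sets_mu_onb)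
      then show "(\<Sum>i. (?R e1 (A i) + ?R e2 (A i)) / 2) = (?R e1 (\<Union>i. A i) + ?R e2 (\<Union>i. A i)) / 2"
        by (simp add: divide_ennreal_def suminf_add[symmetric] summableI)
    qed
    show "E \<in> sets (mu_onb e1 e2)" using E by (simp add: sets_mu_onb)
  qed
  then show ?thesis using E by (simp add: emeasure_return)
qed

lemma mu_onb_in_circle_probs: "mu_onb e1 e2 \<in> circle_probs"
proof -
  have space: "space (mu_onb e1 e2) = circle"
    using sets_eq_imp_space_eq[OF sets_mu_onb] by simp
  have "circle \<in> sets circle_borel"
    using sets.top[of circle_borel] by (simp only: space_circle_borel)
  then have "emeasure (mu_onb e1 e2) circle = (1 + 1) / 2"
    using onb_in_circle by (simp only: emeasure_mu_onb indicator_simps)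
  then have "prob_space (mu_onb e1 e2)"
    by (intro prob_spaceI) (simp only: space, simp)
  then show ?thesis by (simp add: circle_probs_def sets_mu_onb)
qed

lemma two_point_law_mu_onb: "two_point_law (line_angle e1) (angle_law (mu_onb e1 e2))"
  unfolding two_point_law_def
proof
  fix B :: "real set" assume B: "B \<in> sets borel"
  have perp: "line_angle e2 = rot (line_angle e1)"
    using orthogonal_line_angles[OF onb_in_circle] onb by (simp add: orthonormal_basis_def)
  have E: "line_angle -` B \<inter> circle \<in> sets circle_borel"
    using measurable_sets[OF line_angle_measurable B] by (simp only: space_circle_borel)
  have "emeasure (angle_law (mu_onb e1 e2)) B = emeasure (mu_onb e1 e2) (line_angle -` B \<inter> circle)"
    unfolding angle_law_def
    by (subst emeasure_distr[OF line_angle_measurable'[OF mu_onb_in_circle_probs] B])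
      (simp only: circle_probsD(3)[OF mu_onb_in_circle_probs])
  also have "\<dots> = (indicator B (line_angle e1) + indicator B (line_angle e2)) / 2"
    unfolding emeasure_mu_onb[OF E] using onb_in_circle by (simp only: indicator_def Int_iff vimage_eq simp_thms)
  finally show "emeasure (angle_law (mu_onb e1 e2)) B
      = (indicator B (line_angle e1) + indicator B (rot (line_angle e1))) / 2"
    by (simp only: perp)
qed

end

text \<open>The basis belonging to \<open>p\<close> is \<open>dir p, dir (rot p)\<close>.\<close>

lemma proj_equal_mu_onb_iff:
  assumes \<mu>: "\<mu> \<in> circle_probs"
  shows "(\<exists>e1 e2. orthonormal_basis e1 e2 \<and> proj_equal \<mu> (mu_onb e1 e2))
    \<longleftrightarrow> (\<exists>p. 0 < p \<and> p \<le> pi \<and> two_point_law p (angle_law \<mu>))"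
proof
  assume "\<exists>e1 e2. orthonormal_basis e1 e2 \<and> proj_equal \<mu> (mu_onb e1 e2)"
  then obtain e1 e2 where onb: "orthonormal_basis e1 e2" and eq: "proj_equal \<mu> (mu_onb e1 e2)"
    by blast
  have "angle_law \<mu> = angle_law (mu_onb e1 e2)"
    using eq proj_equal_iff_angle_law[OF \<mu> mu_onb_in_circle_probs[OF onb]] by simp
  then show "\<exists>p. 0 < p \<and> p \<le> pi \<and> two_point_law p (angle_law \<mu>)"
    using two_point_law_mu_onb[OF onb] line_angle_range[OF onb_in_circle(1)[OF onb]] by auto
next
  assume "\<exists>p. 0 < p \<and> p \<le> pi \<and> two_point_law p (angle_law \<mu>)"
  then obtain p where p: "0 < p" "p \<le> pi" and two: "two_point_law p (angle_law \<mu>)" by blast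
  have onb: "orthonormal_basis (dir p) (dir (rot p))"
    by (simp add: orthonormal_basis_def dir_perp_rot)
  have "angle_law \<mu> = angle_law (mu_onb (dir p) (dir (rot p)))"
    by (rule measure_eqI)
      (use two two_point_law_mu_onb[OF onb] line_angle_dir[OF p] in \<open>auto simp: angle_law_def two_point_law_def\<close>)
  then show "\<exists>e1 e2. orthonormal_basis e1 e2 \<and> proj_equal \<mu> (mu_onb e1 e2)"
    using onb proj_equal_iff_angle_law[OF \<mu> mu_onb_in_circle_probs[OF onb]] by blast
qed

lemma arc_dist_extreme:
  assumes "0 < u" "u \<le> pi" "0 < v" "v \<le> pi"
  shows "arc_dist u v = 0 \<longleftrightarrow> u = v" and "arc_dist u v = pi/2 \<longleftrightarrow> u = rot v"
  using assms by (cases "u \<le> v"; auto simp: arc_dist_def min_def rot_def)+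

text \<open>With \<open>k = (pi/2) powr (s - 1)\<close> and \<open>e t = k * t - t powr s\<close> one has \<open>gap s t = k * gap 1 t + e t\<close>, where
\<open>e\<close> is nonnegative and vanishes only at \<open>0\<close> and \<open>pi/2\<close>. The first term is least for the laws
invariant under rotation. The second is zero if and only if almost all pairs of angles are equal or
differ by a quarter turn; fixing one such angle \<open>p\<close> shows that the law lives on \<open>p\<close> and \<open>rot p\<close>.\<close>

lemma pair_energy_superlinear:
  assumes s: "1 < s" and M: "line_law M"
  shows "ennreal ((pi/2) powr s / 2) \<le> pair_energy (gap s) M"
    and "pair_energy (gap s) M = ennreal ((pi/2) powr s / 2)
      \<longleftrightarrow> (\<exists>p. 0 < p \<and> p \<le> pi \<and> two_point_law p M)"
proof -
  interpret line_law M by fact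
  define k where "k = (pi/2) powr (s - 1)"
  define e where "e t = k * t - t powr s" for t
  have k: "0 < k" and k_mult: "k * (pi/2) = (pi/2) powr s"
    by (simp_all add: k_def powr_diff)
  have e_eq: "e t = t * (k - t powr (s - 1))" if "0 < t" for t
    using that by (simp add: e_def powr_diff field_simps)
  have e_pos: "0 < e t" if "0 < t" "t < pi/2" for t
    using that s unfolding e_eq[OF that(1)] k_def by (intro mult_pos_pos) (auto intro: powr_less_mono2)
  have e_ends: "e 0 = 0" "e (pi/2) = 0"
    by (simp_all only: e_def k_mult) simp_all
  have e_cases: "(t = 0 \<or> t = pi/2) \<and> e t = 0 \<or> t \<noteq> 0 \<and> t \<noteq> pi/2 \<and> 0 < e t" if "0 \<le> t" "t \<le> pi/2" for t
    using e_pos[of t] e_ends that by (metis less_eq_real_def)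
  have e_nonneg: "0 \<le> e t" if "0 \<le> t" "t \<le> pi/2" for t
    using e_cases[OF that] by auto
  have e_eq_0: "ennreal (e t) = 0 \<longleftrightarrow> t = 0 \<or> t = pi/2" if "0 \<le> t" "t \<le> pi/2" for t
    using e_cases[OF that] by (auto simp only: ennreal_eq_0_iff)
  have [measurable]: "e \<in> borel_measurable borel"
    unfolding e_def by measurable
  have "pair_energy (gap s) M = pair_energy (\<lambda>t. ennreal k * gap 1 t + ennreal (e t)) M"
  proof (rule pair_energy_cong)
    fix t :: real assume t: "0 \<le> t" "t \<le> pi/2"
    have le: "t powr s \<le> (pi/2) powr s" using s t by (intro powr_mono2) auto
    have "gap s t = ennreal ((pi/2) powr s - t powr s)"
      using s le by (simp add: gap_def)
    also have "(pi/2) powr s - t powr s = k * (pi/2 - t) + e t"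
      unfolding e_def right_diff_distrib k_mult by simp
    also have "ennreal \<dots> = ennreal k * gap 1 t + ennreal (e t)"
      using t k e_nonneg[OF t] by (simp add: gap_def ennreal_plus ennreal_mult)
    finally show "gap s t = ennreal k * gap 1 t + ennreal (e t)" .
  qed
  also have "\<dots> = ennreal k * pair_energy (gap 1) M + pair_energy (\<lambda>t. ennreal (e t)) M"
    by (simp add: pair_energy_add pair_energy_cmult)
  finally have J: "pair_energy (gap s) M = ennreal k * pair_energy (gap 1) M + pair_energy (\<lambda>t. ennreal (e t)) M" .
  have half: "ennreal ((pi/2) powr s / 2) = ennreal k * ennreal (pi/4)"
    using k by (simp add: k_mult[symmetric] flip: ennreal_mult)
  have ge: "ennreal k * ennreal (pi/4) \<le> ennreal k * pair_energy (gap 1) M"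
    using gap_1_energy(1) by (rule mult_left_mono) simp
  then show "ennreal ((pi/2) powr s / 2) \<le> pair_energy (gap s) M"
    unfolding J half by (rule add_increasing2[rotated]) simp
  have e_energy: "pair_energy (\<lambda>t. ennreal (e t)) M = 0 \<longleftrightarrow> (AE v in M. AE u in M. u = v \<or> u = rot v)"
  proof -
    have "pair_energy (\<lambda>t. ennreal (e t)) M = 0 \<longleftrightarrow> (AE v in M. AE u in M. ennreal (e (arc_dist u v)) = 0)"
      unfolding pair_energy_def by (simp add: nn_integral_0_iff_AE)
    also have "\<dots> \<longleftrightarrow> (AE v in M. AE u in M. u = v \<or> u = rot v)"
    proof (rule eventually_subst, use support in eventually_elim)
      case (elim v)
      show ?case
      proof (rule eventually_subst, use support in eventually_elim)
        case (elim u)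
        have range: "0 \<le> arc_dist u v" "arc_dist u v \<le> pi/2"
          using arc_dist_range[of u v] elim \<open>0 < v \<and> v \<le> pi\<close> by auto
        show ?case
          using elim \<open>0 < v \<and> v \<le> pi\<close> by (simp only: e_eq_0[OF range] arc_dist_extreme)
      qed
    qed
    finally show ?thesis .
  qed
  let ?c = "ennreal (pi/4)"
  have "pair_energy (gap s) M = ennreal k * ?c \<longleftrightarrow> pair_energy (gap 1) M = ?c \<and> pair_energy (\<lambda>t. ennreal (e t)) M = 0"
  proof
    assume eq: "pair_energy (gap s) M = ennreal k * ?c"
    have "ennreal k * pair_energy (gap 1) M \<le> ennreal k * ?c"
      unfolding eq[symmetric] J by simp
    then have k_eq: "ennreal k * pair_energy (gap 1) M = ennreal k * ?c"
      using ge by (rule antisym)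
    then have "pair_energy (gap 1) M = ?c"
      using k by (subst (asm) ennreal_mult_cancel_left) auto
    moreover have "ennreal k * ?c + pair_energy (\<lambda>t. ennreal (e t)) M = ennreal k * ?c"
      using eq unfolding J k_eq .
    then have "pair_energy (\<lambda>t. ennreal (e t)) M = 0"
      by (auto simp: ennreal_mult_eq_top_iff)
    ultimately show "pair_energy (gap 1) M = ?c \<and> pair_energy (\<lambda>t. ennreal (e t)) M = 0" ..
  qed (simp add: J)
  also have "\<dots> \<longleftrightarrow> distr M borel rot = M \<and> (AE v in M. AE u in M. u = v \<or> u = rot v)"
    by (simp only: gap_1_energy(2) e_energy)
  also have "\<dots> \<longleftrightarrow> (\<exists>p. 0 < p \<and> p \<le> pi \<and> two_point_law p M)"
  proof
    assume inv: "distr M borel rot = M \<and> (AE v in M. AE u in M. u = v \<or> u = rot v)"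
    then have "AE v in M. (0 < v \<and> v \<le> pi) \<and> (AE u in M. u = v \<or> u = rot v)"
      using support by simp
    then obtain p where "0 < p" "p \<le> pi" "AE u in M. u = p \<or> u = rot p"
      using eventually_happens'[OF ae_filter_bot] by blast
    then show "\<exists>p. 0 < p \<and> p \<le> pi \<and> two_point_law p M"
      using inv two_point_law_iff by blast
  next
    assume "\<exists>p. 0 < p \<and> p \<le> pi \<and> two_point_law p M"
    then obtain p where p: "0 < p" "p \<le> pi" and inv: "distr M borel rot = M"
      and AE: "AE u in M. u = p \<or> u = rot p"
      using two_point_law_iff by blast
    from AE have "AE v in M. AE u in M. u = v \<or> u = rot v"
    proof eventually_elim
      case (elim v)
      show ?case
        using AE by eventually_elim (use elim p rot_rot in auto)
    qed
    then show "distr M borel rot = M \<and> (AE v in M. AE u in M. u = v \<or> u = rot v)"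
      using inv by simp
  qed
  finally show "pair_energy (gap s) M = ennreal ((pi/2) powr s / 2)
      \<longleftrightarrow> (\<exists>p. 0 < p \<and> p \<le> pi \<and> two_point_law p M)"
    unfolding half .
qed

section \<open>Extremal measures\<close>

lemma angle_law_eq_uniform_iff:
  assumes \<mu>: "\<mu> \<in> circle_probs"
  shows "(\<forall>x. cdf (angle_law \<mu>) x = max 0 (min 1 (x / pi))) \<longleftrightarrow> proj_equal \<mu> uniform_circle"
proof -
  interpret M: line_law "angle_law \<mu>" by (rule line_law_angle_law[OF \<mu>])
  interpret U: line_law "angle_law uniform_circle" by (rule line_law_angle_law[OF uniform_circle_in_circle_probs])
  have "(\<forall>x. cdf (angle_law \<mu>) x = max 0 (min 1 (x / pi))) \<longleftrightarrow> cdf (angle_law \<mu>) = cdf (angle_law uniform_circle)"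
    by (simp add: fun_eq_iff cdf_uniform_circle)
  also have "\<dots> \<longleftrightarrow> angle_law \<mu> = angle_law uniform_circle"
    using cdf_unique[OF M.real_distribution_axioms U.real_distribution_axioms] by auto
  finally show ?thesis
    by (simp add: proj_equal_iff_angle_law[OF \<mu> uniform_circle_in_circle_probs])
qed

lemma extremizers_uniform:
  assumes s: "-1 < s" "s < 1"
  shows "s \<le> 0 \<Longrightarrow> minimizers s = {\<mu> \<in> circle_probs. proj_equal \<mu> uniform_circle}"
    and "0 < s \<Longrightarrow> maximizers s = {\<mu> \<in> circle_probs. proj_equal \<mu> uniform_circle}"
proof -
  obtain c where min: "\<And>M. line_law M \<Longrightarrow> c \<le> pair_energy (gap s) M"
    and eq: "\<And>M. line_law M \<Longrightarrow> pair_energy (gap s) M = c \<longleftrightarrow> (\<forall>x. cdf M x = max 0 (min 1 (x / pi)))"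
    using gap_energy_minimum[OF s] by metis
  have \<sigma>: "pair_energy (gap s) (angle_law uniform_circle) = c"
    using eq[OF line_law_angle_law[OF uniform_circle_in_circle_probs]] cdf_uniform_circle by blast
  have set: "{\<mu> \<in> circle_probs. pair_energy (gap s) (angle_law \<mu>) = c} = {\<mu> \<in> circle_probs. proj_equal \<mu> uniform_circle}"
    using eq[OF line_law_angle_law] angle_law_eq_uniform_iff by blast
  show "s \<le> 0 \<Longrightarrow> minimizers s = {\<mu> \<in> circle_probs. proj_equal \<mu> uniform_circle}"
    and "0 < s \<Longrightarrow> maximizers s = {\<mu> \<in> circle_probs. proj_equal \<mu> uniform_circle}"
    unfolding set[symmetric]
    by (rule extremizers_eq[OF min[OF line_law_angle_law] uniform_circle_in_circle_probs \<sigma>], assumption+)+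
qed

lemma uniform_circle_orthogonally_symmetric: "orthogonally_symmetric uniform_circle"
proof -
  interpret U: line_law "angle_law uniform_circle" by (rule line_law_angle_law[OF uniform_circle_in_circle_probs])
  have "measure (angle_law uniform_circle) (line_arc (pi/2) z) = 1/2" if "0 \<le> z" "z < pi" for z
    using U.arcs_of_uniform_cdf[OF cdf_uniform_circle, of "pi/2" z] that by simp
  then have "distr (angle_law uniform_circle) borel rot = angle_law uniform_circle"
    by (simp add: U.rot_invariant_iff_half_arcs)
  then show ?thesis
    by (simp add: orthogonally_symmetric_iff[OF uniform_circle_in_circle_probs])
qed

lemma mu_onb_orthogonally_symmetric:
  assumes onb: "orthonormal_basis e1 e2"
  shows "orthogonally_symmetric (mu_onb e1 e2)"
  unfolding orthogonally_symmetric_iff[OF mu_onb_in_circle_probs[OF onb]]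
  using line_law.two_point_law_iff[OF line_law_angle_law[OF mu_onb_in_circle_probs[OF onb]]]
    two_point_law_mu_onb[OF onb] line_angle_range[OF onb_in_circle(1)[OF onb]] by blast

lemma maximizers_1: "maximizers 1 = {\<mu> \<in> circle_probs. orthogonally_symmetric \<mu>}"
proof -
  have J: "pair_energy (gap 1) (angle_law \<mu>) = ennreal (pi/4) \<longleftrightarrow> orthogonally_symmetric \<mu>"
    if "\<mu> \<in> circle_probs" for \<mu>
    using line_law.gap_1_energy(2)[OF line_law_angle_law[OF that]] orthogonally_symmetric_iff[OF that] by simp
  have "maximizers 1 = {\<mu> \<in> circle_probs. pair_energy (gap 1) (angle_law \<mu>) = ennreal (pi/4)}"
    by (rule extremizers_eq(2)[OF line_law.gap_1_energy(1)[OF line_law_angle_law] uniform_circle_in_circle_probs])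
      (simp_all add: J uniform_circle_in_circle_probs uniform_circle_orthogonally_symmetric)
  then show ?thesis using J by blast
qed

lemma maximizers_gt_1:
  assumes s: "1 < s"
  shows "maximizers s = {\<mu> \<in> circle_probs. \<exists>e1 e2. orthonormal_basis e1 e2 \<and> proj_equal \<mu> (mu_onb e1 e2)}"
proof -
  let ?c = "ennreal ((pi/2) powr s / 2)"
  have J: "pair_energy (gap s) (angle_law \<mu>) = ?c
      \<longleftrightarrow> (\<exists>e1 e2. orthonormal_basis e1 e2 \<and> proj_equal \<mu> (mu_onb e1 e2))"
    if "\<mu> \<in> circle_probs" for \<mu>
    using pair_energy_superlinear(2)[OF s line_law_angle_law[OF that]] proj_equal_mu_onb_iff[OF that] by simp
  have onb: "orthonormal_basis (dir 0) (dir (rot 0))"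
    by (simp add: orthonormal_basis_def dir_perp_rot)
  have attained: "pair_energy (gap s) (angle_law (mu_onb (dir 0) (dir (rot 0)))) = ?c"
    unfolding J[OF mu_onb_in_circle_probs[OF onb]] using onb by (auto simp: proj_equal_def)
  have "maximizers s = {\<mu> \<in> circle_probs. pair_energy (gap s) (angle_law \<mu>) = ?c}"
    by (rule extremizers_eq(2)[OF pair_energy_superlinear(1)[OF s line_law_angle_law]
          mu_onb_in_circle_probs[OF onb] attained]) (use s in simp_all)
  then show ?thesis using J by blast
qed

theorem theorem1p2:
  shows
    "(\<forall>s::real. -1 < s \<and> s \<le> 0 \<longrightarrow>
        uniform_circle \<in> minimizers s \<and>
        minimizers s = {\<mu> \<in> circle_probs. proj_equal \<mu> uniform_circle}) \<and>
     (\<forall>s::real. 0 < s \<and> s < 1 \<longrightarrow>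
        uniform_circle \<in> maximizers s \<and>
        maximizers s = {\<mu> \<in> circle_probs. proj_equal \<mu> uniform_circle}) \<and>
     (maximizers 1 = {\<mu> \<in> circle_probs. orthogonally_symmetric \<mu>} \<and>
      uniform_circle \<in> maximizers 1 \<and>
      (\<forall>e1 e2. orthonormal_basis e1 e2 \<longrightarrow> mu_onb e1 e2 \<in> maximizers 1)) \<and>
     (\<forall>s>1.
        (\<forall>e1 e2. orthonormal_basis e1 e2 \<longrightarrow> mu_onb e1 e2 \<in> maximizers s) \<and>
        maximizers s =
          {\<mu> \<in> circle_probs. \<exists>e1 e2. orthonormal_basis e1 e2 \<and> proj_equal \<mu> (mu_onb e1 e2)})"
proof (intro conjI allI impI)
  have refl: "proj_equal \<mu> \<mu>" for \<mu> by (simp add: proj_equal_def)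
  note \<sigma> = uniform_circle_in_circle_probs
  fix s :: real
  show "minimizers s = {\<mu> \<in> circle_probs. proj_equal \<mu> uniform_circle}"
    and "uniform_circle \<in> minimizers s" if "-1 < s \<and> s \<le> 0"
    using extremizers_uniform(1)[of s] that \<sigma> refl by auto
  show "maximizers s = {\<mu> \<in> circle_probs. proj_equal \<mu> uniform_circle}"
    and "uniform_circle \<in> maximizers s" if "0 < s \<and> s < 1"
    using extremizers_uniform(2)[of s] that \<sigma> refl by auto
  show "maximizers s = {\<mu> \<in> circle_probs. \<exists>e1 e2. orthonormal_basis e1 e2 \<and> proj_equal \<mu> (mu_onb e1 e2)}" if "1 < s"
    by (rule maximizers_gt_1[OF that])
  fix e1 e2 assume onb: "orthonormal_basis e1 e2"
  show "mu_onb e1 e2 \<in> maximizers s" if "1 < s"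
    unfolding maximizers_gt_1[OF that] using onb mu_onb_in_circle_probs[OF onb] refl by blast
  show "mu_onb e1 e2 \<in> maximizers 1"
    unfolding maximizers_1 using mu_onb_in_circle_probs[OF onb] mu_onb_orthogonally_symmetric[OF onb] by simp
next
  show "uniform_circle \<in> maximizers 1"
    unfolding maximizers_1 using uniform_circle_in_circle_probs uniform_circle_orthogonally_symmetric by simp
qed (rule maximizers_1)

end
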